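(* Fix an integer $m\ge2$, $k=2$ or $k=3$, and constants $\chi_0=1$, $\chi_1,\dots,\chi_m\ge0$. Let $\{p_j\}_{j\ge0}$ be the monic Legendre orthogonal polynomials and $\{\tilde s_n\}_{n\ge0}$ the monic orthogonal polynomials with respect to $\langle f,g\rangle_{S^m}=\sum_{\ell=0}^m\chi_\ell\int_{SG}\Delta^\ell f\,\Delta^\ell g\,d\mu$, both of the family $k$. For $j\ge0$ put $\mathcal F_{m+j}=\mathcal G^mp_j$, and for $N\ge-1$ and $-1\le\ell\le2m-1$ with $N+m-\ell\ge0$ put $$a_{N,\ell}=\frac{\langle\mathcal F_{N+m+1},\tilde s_{N+m-\ell}\rangle_{S^m}}{\|\tilde s_{N+m-\ell}\|_{S^m}^2}$$ (so $a_{N,-1}=1$). Let $d_n^{-2}=\|p_n\|_2^2$ and $\tilde\xi_n^{-2}=\|\tilde s_n\|_{S^m}^2$. Then for each $n\ge m$ $$\tilde s_n+\sum_{l=1}^m\chi_l\,\Delta^{2l}\tilde s_n=\Delta^mp_{n+m}+\sum_{l=1}^{2m}d_{n+m-l}^2\,\tilde\xi_n^{-2}\,a_{n+m-l-1,\,2m-l-1}\,\Delta^mp_{n+m-l}.$$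
   Context: Sierpinski gasket: let $q_0=(\tfrac12,\tfrac{\sqrt3}{2})$, $q_1=(0,0)$, $q_2=(1,0)$, $V_0=\{q_0,q_1,q_2\}$, $F_i(x)=\tfrac12(x-q_i)+q_i$, and let $SG\subset\mathbb R^2$ be the unique nonempty compact set with $SG=\bigcup_{i=0}^2F_i(SG)$. For a word $w=(w_1,\dots,w_r)\in\{0,1,2\}^r$, $|w|=r$, put $F_w=F_{w_1}\circ\cdots\circ F_{w_r}$; $F_w(SG)$ is called an $r$-cell; $V_r=\bigcup_{|w|=r}F_w(V_0)$; distinct $x,y\in V_r$ satisfy $x\sim_r y$ if they lie in a common $r$-cell. $\mu$ is the self-similar Borel probability measure with $\mu(F_w(SG))=3^{-|w|}$. All functions are real-valued. Energy and Laplacian: $\mathscr E(u,v)=\lim_{r\to\infty}(3/5)^{-r}\sum_{x\sim_r y}(u(x)-u(y))(v(x)-v(y))$ (sum over unordered pairs), and $u\in\operatorname{dom}\mathscr E$ if $\mathscr E(u,u)$ exists and is finite. For $u\in\operatorname{dom}\mathscr E$ and $f$ continuous, $\Delta u=f$ means $\mathscr E(u,v)=-\int_{SG}fv\,d\mu$ for all $v\in\operatorname{dom}\mathscr E$ vanishing on $V_0$. Indices of $q_i$ are mod 3. Normal derivative: $\partial_nu(q_i)=\lim_r(5/3)^r(2u(q_i)-u(F_i^rq_{i+1})-u(F_i^rq_{i-1}))$. Tangential derivative: $\partial_Tu(q_i)=\lim_r5^r(u(F_i^rq_{i+1})-u(F_i^rq_{i-1}))$. Green operator: for $f$ continuous,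 $\mathcal Gf=-\int_{SG}G(\cdot,y)f(y)\,d\mu(y)$ is the unique function with $\Delta(\mathcal Gf)=f$ and $\mathcal Gf|_{V_0}=0$ ($G$ the Dirichlet Green's function); $\mathcal G^m$ is its $m$-fold composition. Monomials: for $j\ge0$, $k\in\{1,2,3\}$, $P_{j,k}$ is the unique function with $\Delta^{j+1}P_{j,k}=0$ such that for all $0\le n\le j$: $\Delta^nP_{j,k}(q_0)=\delta_{nj}\delta_{k1}$, $\partial_n\Delta^nP_{j,k}(q_0)=\delta_{nj}\delta_{k2}$, $\partial_T\Delta^nP_{j,k}(q_0)=\delta_{nj}\delta_{k3}$. In particular $\Delta P_{j,k}=P_{j-1,k}$ with $P_{-1,k}=0$. Orthogonal polynomials: for fixed $k$, $\{p_n\}$ and $\{\tilde s_n\}$ are obtained from $P_{0,k},P_{1,k},\dots$ by Gram-Schmidt without normalization with respect to $\langle f,g\rangle_2=\int_{SG}fg\,d\mu$ (norm $\|\cdot\|_2$) and $\langle\cdot,\cdot\rangle_{S^m}$ (norm $\|\cdot\|_{S^m}$) respectively; i.e. each of $p_n$, $\tilde s_n$ equals $P_{n,k}$ plus a linear combination of $P_{0,k},\dots,P_{n-1,k}$ and is orthogonal to $P_{0,k},\dots,P_{n-1,k}$. *)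

theory Defs
  imports "HOL-Probability.Probability"
begin

section \<open>The Sierpinski gasket\<close>

type_synonym plane = "real^2"

text \<open>Vertex indices are read modulo 3, so \<open>q (i + 2)\<close> is $q_{i-1}$.\<close>

definition q :: "nat \<Rightarrow> plane" where
  "q i = (if i mod 3 = 0 then vector [1/2, sqrt 3 / 2]
          else if i mod 3 = 1 then vector [0, 0]
          else vector [1, 0])"

definition F :: "nat \<Rightarrow> plane \<Rightarrow> plane" where
  "F i x = (1/2) *\<^sub>R (x - q i) + q i"

definition SG :: "plane set" where
  "SG = (THE K. compact K \<and> K \<noteq> {} \<and> K = (\<Union>i<3. F i ` K))"

definition words :: "nat \<Rightarrow> nat list set" where
  "words r = {w. length w = r \<and> set w \<subseteq> {..<3}}"

primrec Fw :: "nat list \<Rightarrow> plane \<Rightarrow> plane" where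
  "Fw [] = id"
| "Fw (i # w) = F i \<circ> Fw w"

definition V0 :: "plane set" where
  "V0 = q ` {..<3}"

definition V :: "nat \<Rightarrow> plane set" where
  "V r = (\<Union>w\<in>words r. Fw w ` V0)"

definition adj :: "nat \<Rightarrow> plane \<Rightarrow> plane \<Rightarrow> bool" where
  "adj r x y \<longleftrightarrow> x \<in> V r \<and> y \<in> V r \<and> x \<noteq> y \<and>
     (\<exists>w\<in>words r. x \<in> Fw w ` SG \<and> y \<in> Fw w ` SG)"

definition is_SG_measure :: "plane measure \<Rightarrow> bool" where
  "is_SG_measure M \<longleftrightarrow> prob_space M \<and> sets M = sets borel \<and>
     (\<forall>A\<in>sets borel. measure M A = (\<Sum>i<3. measure M (F i -` A)) / 3) \<and>
     (\<forall>r. \<forall>w\<in>words r. measure M (Fw w ` SG) = 1 / 3 ^ r)"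

definition \<mu> :: "plane measure" where
  "\<mu> = (THE M. is_SG_measure M)"


section \<open>Energy and Laplacian\<close>

text \<open>
  Functions on the gasket are represented by functions on the plane of which only the values
  on \<open>SG\<close> matter.  The graph energy sums over ordered pairs, hence the factor \<open>1/2\<close>.
\<close>

definition graph_energy :: "nat \<Rightarrow> (plane \<Rightarrow> real) \<Rightarrow> (plane \<Rightarrow> real) \<Rightarrow> real" where
  "graph_energy r u v =
     (5/3) ^ r * ((1/2) * (\<Sum>(x, y) \<in> {(x, y). adj r x y}. (u x - u y) * (v x - v y)))"

definition energy :: "(plane \<Rightarrow> real) \<Rightarrow> (plane \<Rightarrow> real) \<Rightarrow> real" where
  "energy u v = lim (\<lambda>r. graph_energy r u v)"

text \<open>
  The graph energies only see the vertices $\bigcup_r V_r$.  As usual, a function of finite energy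
  is identified with its continuous extension, so continuity is part of the domain.
\<close>

definition dom_energy :: "(plane \<Rightarrow> real) set" where
  "dom_energy = {u. continuous_on SG u \<and> convergent (\<lambda>r. graph_energy r u u)}"

definition has_laplacian :: "(plane \<Rightarrow> real) \<Rightarrow> (plane \<Rightarrow> real) \<Rightarrow> bool" where
  "has_laplacian u f \<longleftrightarrow> u \<in> dom_energy \<and> continuous_on SG f \<and>
     (\<forall>v\<in>dom_energy. (\<forall>x\<in>V0. v x = 0) \<longrightarrow>
        energy u v = - (LINT x:SG|\<mu>. f x * v x))"

text \<open>The value off \<open>SG\<close> is fixed to be 0 to make the description definite.\<close>

definition laplacian :: "(plane \<Rightarrow> real) \<Rightarrow> plane \<Rightarrow> real" where
  "laplacian u = (THE f. has_laplacian u f \<and> (\<forall>x. x \<notin> SG \<longrightarrow> f x = 0))"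

definition dom_laplacian_pow :: "nat \<Rightarrow> (plane \<Rightarrow> real) set" where
  "dom_laplacian_pow n = {u. \<forall>i<n. \<exists>f. has_laplacian ((laplacian ^^ i) u) f}"

definition has_normal_deriv :: "(plane \<Rightarrow> real) \<Rightarrow> real \<Rightarrow> nat \<Rightarrow> bool" where
  "has_normal_deriv u D i \<longleftrightarrow>
     (\<lambda>r. (5/3) ^ r * (2 * u (q i) - u ((F i ^^ r) (q (i + 1))) - u ((F i ^^ r) (q (i + 2)))))
       \<longlonglongrightarrow> D"

definition has_tangential_deriv :: "(plane \<Rightarrow> real) \<Rightarrow> real \<Rightarrow> nat \<Rightarrow> bool" where
  "has_tangential_deriv u D i \<longleftrightarrow>
     (\<lambda>r. 5 ^ r * (u ((F i ^^ r) (q (i + 1))) - u ((F i ^^ r) (q (i + 2))))) \<longlonglongrightarrow> D"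

definition green :: "(plane \<Rightarrow> real) \<Rightarrow> plane \<Rightarrow> real" where
  "green f = (THE u. has_laplacian u f \<and> (\<forall>x\<in>V0. u x = 0) \<and> (\<forall>x. x \<notin> SG \<longrightarrow> u x = 0))"


section \<open>Monomials and orthogonal polynomials\<close>

text \<open>The conditions that determine the monomial $P_{j,k}$ as a function on \<open>SG\<close>.\<close>

definition is_monomial :: "nat \<Rightarrow> nat \<Rightarrow> (plane \<Rightarrow> real) \<Rightarrow> bool" where
  "is_monomial j k u \<longleftrightarrow> u \<in> dom_laplacian_pow (j + 1) \<and>
     (\<forall>x\<in>SG. (laplacian ^^ (j + 1)) u x = 0) \<and>
     (\<forall>n\<le>j. (laplacian ^^ n) u (q 0) = of_bool (n = j \<and> k = 1) \<and>
             has_normal_deriv ((laplacian ^^ n) u) (of_bool (n = j \<and> k = 2)) 0 \<and>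
             has_tangential_deriv ((laplacian ^^ n) u) (of_bool (n = j \<and> k = 3)) 0)"

definition L2_inner :: "(plane \<Rightarrow> real) \<Rightarrow> (plane \<Rightarrow> real) \<Rightarrow> real" where
  "L2_inner f g = (LINT x:SG|\<mu>. f x * g x)"

definition sobolev_inner ::
  "nat \<Rightarrow> (nat \<Rightarrow> real) \<Rightarrow> (plane \<Rightarrow> real) \<Rightarrow> (plane \<Rightarrow> real) \<Rightarrow> real" where
  "sobolev_inner m chi f g =
     (\<Sum>l\<le>m. chi l * L2_inner ((laplacian ^^ l) f) ((laplacian ^^ l) g))"

fun gram_schmidt ::
  "((plane \<Rightarrow> real) \<Rightarrow> (plane \<Rightarrow> real) \<Rightarrow> real) \<Rightarrow> (nat \<Rightarrow> plane \<Rightarrow> real) \<Rightarrow> nat \<Rightarrow> plane \<Rightarrow> real"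
where
  "gram_schmidt ip P n =
     (\<lambda>x. P n x - (\<Sum>i<n. ip (P n) (gram_schmidt ip P i)
                           / ip (gram_schmidt ip P i) (gram_schmidt ip P i)
                           * gram_schmidt ip P i x))"

declare gram_schmidt.simps [simp del]

definition legendre :: "(nat \<Rightarrow> plane \<Rightarrow> real) \<Rightarrow> nat \<Rightarrow> plane \<Rightarrow> real" where
  "legendre P = gram_schmidt L2_inner P"

definition sobolev ::
  "nat \<Rightarrow> (nat \<Rightarrow> real) \<Rightarrow> (nat \<Rightarrow> plane \<Rightarrow> real) \<Rightarrow> nat \<Rightarrow> plane \<Rightarrow> real" where
  "sobolev m chi P = gram_schmidt (sobolev_inner m chi) P"

text \<open>The function $\mathcal F_i$, meaningful for \<open>i \<ge> m\<close>.\<close>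

definition green_legendre :: "nat \<Rightarrow> (nat \<Rightarrow> plane \<Rightarrow> real) \<Rightarrow> nat \<Rightarrow> plane \<Rightarrow> real" where
  "green_legendre m P i = (green ^^ m) (legendre P (i - m))"

text \<open>
  The coefficient $a_{N,\ell}$.  The indices are integers because \<open>-1\<close> is allowed for both;
  it is used for \<open>N \<ge> -1\<close>, \<open>-1 \<le> l \<le> 2 * m - 1\<close> and \<open>N + m - l \<ge> 0\<close>.
\<close>

definition coeff_a ::
  "nat \<Rightarrow> (nat \<Rightarrow> real) \<Rightarrow> (nat \<Rightarrow> plane \<Rightarrow> real) \<Rightarrow> int \<Rightarrow> int \<Rightarrow> real" where
  "coeff_a m chi P N l =
     (let s = sobolev m chi P (nat (N + int m - l))
      in sobolev_inner m chi (green_legendre m P (nat (N + int m + 1))) s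
         / sobolev_inner m chi s s)"

text \<open>The numbers $d_n^2$ and $\tilde\xi_n^{-2}$.\<close>

definition d_sq :: "(nat \<Rightarrow> plane \<Rightarrow> real) \<Rightarrow> nat \<Rightarrow> real" where
  "d_sq P n = inverse (L2_inner (legendre P n) (legendre P n))"

definition xi_inv_sq :: "nat \<Rightarrow> (nat \<Rightarrow> real) \<Rightarrow> (nat \<Rightarrow> plane \<Rightarrow> real) \<Rightarrow> nat \<Rightarrow> real" where
  "xi_inv_sq m chi P n = sobolev_inner m chi (sobolev m chi P n) (sobolev m chi P n)"

end

theory Submission
  imports Defs "HOL-Computational_Algebra.Polynomial"
begin

text \<open>
  By self-adjointness of the Green operator $\mathcal G$,
  $\langle \mathcal G^m p, \tilde s_n\rangle_{S^m} = \langle p, h\rangle_2$ with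
  $h = \sum_l \chi_l \mathcal G^{m-l}\Delta^l \tilde s_n$.  For \<open>k = 2, 3\<close> the reflection
  symmetry of $P_{j,k}$ shows that $\mathcal G$ maps the span of the family into itself, so $h$ is a
  monic polynomial of degree $n + m$, and $\Delta^m h$ is the left-hand side.  Expanding $h$ in the
  Legendre basis, the coefficient of $p_j$ is a multiple of
  $\langle \mathcal G^m p_j, \tilde s_n\rangle_{S^m}$, which vanishes for $j + m < n$.

  The descriptions defining \<open>SG\<close>, \<open>\<mu>\<close>, the Laplacian and the Green operator have to be justified:
  \<open>SG\<close> is the closure of the vertices, \<open>\<mu>\<close> is the law of a random address, and
  uniqueness of the Laplacian follows from bump functions built out of harmonic functions.
\<close>

section \<open>Geometry of the gasket\<close>

text \<open>The Green operator corrects a solution of Delta u = f by a harmonic function. Harmonic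
  functions form a space of dimension three, of which one family contains only the line spanned by
  \<open>P 0\<close>. For k = 2, 3 every \<open>P j\<close> vanishes at \<open>q 0\<close> and is
  even or odd under the reflection exchanging \<open>q 1\<close> and \<open>q 2\<close>, so the
  boundary values of the family also fill only one line, and a multiple of \<open>P 0\<close> is the
  right correction.

  The Dirichlet problem is therefore never solved for general f; solutions are exhibited on
  polynomials and uniqueness does the rest. A function of the family is coded as a
  \<open>real poly\<close> in which X^j stands for \<open>P j\<close>. The Laplacian drops the
  constant coefficient and shifts down, the Green operator shifts up and prepends a coefficient, and
  Delta^m G^(m-l) Delta^l = Delta^(2l) is an identity of coefficients. That h is monic rests on
  chi_0 = 1, and the sum has 2m terms because the indices j below n + m that can survive are n - m,
  ..., n + m - 1.\<close>

lemma less_3_iff: "i < (3::nat) \<longleftrightarrow> i = 0 \<or> i = 1 \<or> i = 2"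
  by auto

lemma lessThan_3: "{..<3::nat} = {0, 1, 2}"
  by auto

lemma q_simps: "q 0 = vector [1/2, sqrt 3 / 2]" "q (Suc 0) = vector [0, 0]" "q 2 = vector [1, 0]"
  by (simp_all add: q_def)

text \<open>Barycentric coordinates for the triangle \<open>q 0\<close>, \<open>q 1\<close>,
  \<open>q 2\<close>, whose height is \<open>sqrt 3 / 2\<close>. Incidences between cells and
  symmetries are read off from them.\<close>

definition bary :: "nat \<Rightarrow> plane \<Rightarrow> real" where
  "bary i x = (if i = 0 then 2 * x $ 2 / sqrt 3
     else if i = 1 then 1 - x $ 1 - x $ 2 / sqrt 3 else x $ 1 - x $ 2 / sqrt 3)"

lemma bary_q: "i < 3 \<Longrightarrow> j < 3 \<Longrightarrow> bary j (q i) = of_bool (i = j)"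
  by (auto simp: less_3_iff bary_def q_simps)

lemma bary_F: "i < 3 \<Longrightarrow> j < 3 \<Longrightarrow> bary j (F i x) = (bary j x + of_bool (i = j)) / 2"
  by (auto simp: less_3_iff bary_def F_def q_simps field_simps)

lemma bary_sum: "bary 0 x + bary 1 x + bary 2 x = 1"
  by (simp add: bary_def field_simps)

lemma bary_eqI:
  assumes "\<And>i. i < 3 \<Longrightarrow> bary i x = bary i y"
  shows "x = y"
proof -
  have "x $ 2 = y $ 2" using assms[of 0] by (simp add: bary_def)
  moreover from this have "x $ 1 = y $ 1" using assms[of 1] by (simp add: bary_def)
  ultimately show ?thesis by (simp add: vec_eq_iff forall_2)
qed

lemma continuous_bary [continuous_intros]: "continuous_on A (bary i)"
  unfolding bary_def by (cases "i = 0"; cases "i = 1") (auto intro!: continuous_intros)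

lemma F_alt: "F i x = (1/2) *\<^sub>R (x + q i)"
  by (simp add: F_def vec_eq_iff field_simps)

lemma dist_F: "dist (F i x) (F i y) = dist x y / 2"
  by (simp add: F_alt dist_norm flip: scaleR_diff_right)

lemma inj_F: "inj (F i)"
  by (rule injI) (simp add: F_alt)

lemma F_eq_iff [simp]: "F i x = F i y \<longleftrightarrow> x = y"
  using inj_F by (simp add: inj_eq)

lemma continuous_F [continuous_intros]: "continuous_on A (F i)"
  unfolding F_def by (intro continuous_intros)

lemma F_fixed [simp]: "F i (q i) = q i"
  by (simp add: F_def)

lemma F_q_swap: "F i (q j) = F j (q i)"
  by (simp add: F_alt add.commute)

section \<open>Words and vertices of all levels\<close>

lemma words_0 [simp]: "words 0 = {[]}"
  by (auto simp: words_def)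

lemma words_Suc: "words (Suc r) = (\<Union>i<3. (#) i ` words r)"
  unfolding words_def by (auto simp: length_Suc_conv)

lemma finite_words: "finite (words r)"
  by (induction r) (auto simp: words_Suc)

lemma V_0 [simp]: "V 0 = V0"
  by (simp add: V_def)

lemma V_Suc: "V (Suc r) = (\<Union>i<3. F i ` V r)"
  by (auto simp: V_def words_Suc image_iff)

lemma q_in_V0: "i < 3 \<Longrightarrow> q i \<in> V0"
  by (auto simp: V0_def)

lemma V_mono_Suc: "V r \<subseteq> V (Suc r)"
proof (induction r)
  case 0
  show ?case
  proof
    fix x assume "x \<in> V 0"
    then obtain i where "i < 3" "x = q i" "q i \<in> V 0" by (auto simp: V0_def)
    then show "x \<in> V (Suc 0)"
      unfolding V_Suc using F_fixed[of i] by (auto simp: image_iff intro!: bexI[of _ i] bexI[of _ "q i"])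
  qed
next
  case (Suc r)
  show ?case
    using Suc.IH V_Suc[of r] V_Suc[of "Suc r"] by blast
qed

lemma V0_subset_V: "V0 \<subseteq> V r"
  by (induction r) (use V_mono_Suc in auto)

lemma finite_V: "finite (V r)"
  by (induction r) (auto simp: V_Suc V0_def)

definition Vstar :: "plane set" where
  "Vstar = (\<Union>r. V r)"

lemma Vstar_fixed: "Vstar = (\<Union>i<3. F i ` Vstar)"
proof -
  have "Vstar = (\<Union>r. V (Suc r))"
    unfolding Vstar_def using V_mono_Suc by blast
  then show ?thesis
    unfolding Vstar_def V_Suc by blast
qed

lemma bary_Vstar_nonneg: "x \<in> Vstar \<Longrightarrow> i < 3 \<Longrightarrow> bary i x \<ge> 0"
proof -
  have "\<forall>x\<in>V r. \<forall>i<3. bary i x \<ge> 0" for r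
  proof (induction r)
    case 0
    show ?case by (auto simp: V0_def bary_q)
  next
    case (Suc r)
    then show ?case by (auto simp: V_Suc bary_F)
  qed
  then show "x \<in> Vstar \<Longrightarrow> i < 3 \<Longrightarrow> bary i x \<ge> 0"
    by (auto simp: Vstar_def)
qed

section \<open>The self-similar compact set\<close>

lemma bounded_bary_nonneg:
  assumes "\<And>x i. x \<in> A \<Longrightarrow> i < 3 \<Longrightarrow> bary i x \<ge> 0"
  shows "bounded A"
proof (rule boundedI)
  fix x assume x: "x \<in> A"
  have n: "bary 0 x \<ge> 0" "bary 1 x \<ge> 0" "bary 2 x \<ge> 0"
    using assms[OF x] by auto
  have s: "sqrt 3 > 0" "sqrt 3 \<le> 2" by (auto intro: real_le_lsqrt)
  have 1: "x $ 2 \<ge> 0"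
    using n(1) s by (simp add: bary_def zero_le_mult_iff zero_le_divide_iff)
  have "x $ 2 / sqrt 3 \<ge> 0" using 1 s by simp
  then have 2: "x $ 1 \<ge> 0" "x $ 1 \<le> 1"
    using n unfolding bary_def by auto
  have "x $ 2 / sqrt 3 \<le> 1 - x $ 1"
    using n(2) by (simp add: bary_def)
  with 2 have "x $ 2 / sqrt 3 \<le> 1" by linarith
  then have 3: "x $ 2 \<le> 2" using s by (simp add: field_simps)
  have "norm x \<le> (\<Sum>i\<in>UNIV. \<bar>x $ i\<bar>)" by (rule norm_le_l1_cart)
  also have "\<dots> \<le> 3" using 1 2 3 by (simp add: sum_2)
  finally show "norm x \<le> 3" .
qed

lemma closure_F_image: "closure (F i ` A) = F i ` closure A"
proof -
  have "F i ` X = (+) ((1/2) *\<^sub>R q i) ` ((*\<^sub>R) (1/2) ` X)" for X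
    by (simp add: image_image F_alt scaleR_add_right add.commute)
  then show ?thesis
    by (simp add: closure_translation closure_scaleR)
qed

text \<open>A point of \<open>K\<close> at maximal distance from \<open>L\<close> has the form
  \<open>F i y\<close> with \<open>y\<close> in \<open>K\<close>. Since \<open>F i\<close> halves
  distances and maps \<open>L\<close> into itself, the maximal distance is at most half of itself,
  hence 0.\<close>

lemma self_similar_subset:
  assumes K: "compact K" "K \<noteq> {}" "K = (\<Union>i<3. F i ` K)"
    and L: "compact L" "L \<noteq> {}" "L = (\<Union>i<3. F i ` L)"
  shows "K \<subseteq> L"
proof -
  have "continuous_on K (\<lambda>x. infdist x L)"
    by (intro continuous_intros)
  from continuous_attains_sup[OF K(1,2) this]
  obtain x where x: "x \<in> K" "\<And>y. y \<in> K \<Longrightarrow> infdist y L \<le> infdist x L"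
    by blast
  from K(3) x(1) obtain i y where i: "i < 3" "y \<in> K" "x = F i y" by blast
  have "closed L" using L by (simp add: compact_imp_closed)
  then obtain z where z: "z \<in> L" "infdist y L = dist y z"
    using infdist_attains_inf[of L y] L by blast
  have "F i z \<in> L" using L(3) z i by blast
  then have "infdist x L \<le> dist x (F i z)" by (rule infdist_le)
  also have "\<dots> = infdist y L / 2" using i z by (simp add: dist_F)
  also have "\<dots> \<le> infdist x L / 2" using x(2)[OF i(2)] by simp
  finally have "infdist x L = 0" using infdist_nonneg[of x L] by linarith
  then have "infdist y L = 0" if "y \<in> K" for y
    using x(2)[OF that] infdist_nonneg[of y L] by simp
  then show ?thesis
    using \<open>closed L\<close> L(2) in_closed_iff_infdist_zero by blast
qed

text \<open>\<open>Vstar\<close> is invariant, and closure commutes with the affine maps and with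
  finite unions, so its closure is a solution; comparison in both directions makes it the only one.
  Self-similarity comes out here as well, since it is available as soon as the description is
  justified.\<close>

lemma SG_eq_closure: "SG = closure Vstar"
  and SG_self_similar: "SG = (\<Union>i<3. F i ` SG)"
proof -
  let ?P = "\<lambda>K. compact K \<and> K \<noteq> {} \<and> K = (\<Union>i<3. F i ` K)"
  have "q 0 \<in> V 0" by (simp add: q_in_V0)
  then have "Vstar \<noteq> {}" unfolding Vstar_def by blast
  moreover have "compact (closure Vstar)"
    using bounded_bary_nonneg[OF bary_Vstar_nonneg] by (simp add: compact_closure)
  moreover have "closure Vstar = (\<Union>i<3. F i ` closure Vstar)"
  proof -
    have "closure Vstar = closure (\<Union>i<3. F i ` Vstar)" using Vstar_fixed by simp
    also have "\<dots> = (\<Union>i<3. F i ` closure Vstar)"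
      by (simp add: closure_Un closure_F_image lessThan_3)
    finally show ?thesis .
  qed
  ultimately have P: "?P (closure Vstar)" by (metis closure_eq_empty)
  show "SG = closure Vstar"
    unfolding SG_def
  proof (rule the_equality[where P = ?P, OF P])
    fix K assume "?P K"
    then have K: "compact K" "K \<noteq> {}" "K = (\<Union>i<3. F i ` K)" by blast+
    from P have C: "compact (closure Vstar)" "closure Vstar \<noteq> {}"
      "closure Vstar = (\<Union>i<3. F i ` closure Vstar)" by blast+
    show "K = closure Vstar"
      by (rule equalityI; rule self_similar_subset) (fact K C)+
  qed
  with P show "SG = (\<Union>i<3. F i ` SG)" by simp
qed

lemma compact_SG: "compact SG"
  unfolding SG_eq_closure
  using bounded_bary_nonneg[OF bary_Vstar_nonneg] by (simp add: compact_closure)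

lemma V_subset_SG: "V r \<subseteq> SG"
proof -
  have "V r \<subseteq> Vstar" by (auto simp: Vstar_def)
  also have "\<dots> \<subseteq> SG" by (simp add: SG_eq_closure closure_subset)
  finally show ?thesis .
qed

lemma q_in_SG: "i < 3 \<Longrightarrow> q i \<in> SG"
  using V_subset_SG[of 0] q_in_V0 by auto

lemma F_in_SG: "i < 3 \<Longrightarrow> x \<in> SG \<Longrightarrow> F i x \<in> SG"
  using SG_self_similar by blast

lemma bary_SG_nonneg: "x \<in> SG \<Longrightarrow> i < 3 \<Longrightarrow> bary i x \<ge> 0"
proof -
  assume "x \<in> SG" "i < 3"
  have "closed {x. bary i x \<ge> 0}"
    by (intro closed_Collect_le continuous_intros)
  moreover have "Vstar \<subseteq> {x. bary i x \<ge> 0}"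
    using bary_Vstar_nonneg \<open>i < 3\<close> by auto
  ultimately have "closure Vstar \<subseteq> {x. bary i x \<ge> 0}"
    by (rule closure_minimal[rotated])
  then show "bary i x \<ge> 0"
    using \<open>x \<in> SG\<close> by (auto simp: SG_eq_closure)
qed

lemma bary_SG_eq_1:
  assumes "x \<in> SG" "i < 3" "bary i x \<ge> 1"
  shows "x = q i"
proof (rule bary_eqI)
  fix j :: nat assume "j < 3"
  then show "bary j x = bary j (q i)"
    using assms bary_SG_nonneg[OF assms(1), of 0] bary_SG_nonneg[OF assms(1), of 1]
      bary_SG_nonneg[OF assms(1), of 2] bary_sum[of x]
    by (auto simp: bary_q less_3_iff)
qed

text \<open>Two distinct 1-cells \<open>i \<noteq> j\<close> meet where both barycentric coordinates are at least 1/2.\<close>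

lemma cells_meet:
  assumes "i < 3" "j < 3" "i \<noteq> j" "x \<in> SG" "y \<in> SG" "F i x = F j y"
  shows "x = q j"
proof (rule bary_SG_eq_1)
  have "bary j (F i x) = bary j (F j y)" using assms by simp
  then show "bary j x \<ge> 1"
    using assms(1-3) bary_SG_nonneg[OF assms(5,2)] by (simp only: bary_F) simp
qed (use assms in auto)

text \<open>The vertex \<open>F i x\<close> may be produced by another 1-cell. The two cells then
  share only a corner, so \<open>x\<close> is a boundary point and thus a vertex of every
  level.\<close>

lemma F_in_V_Suc:
  assumes "i < 3" "x \<in> SG" "F i x \<in> V (Suc r)"
  shows "x \<in> V r"
proof -
  obtain j z where z: "j < 3" "z \<in> V r" "F i x = F j z"
    using assms by (auto simp: V_Suc)
  show ?thesis
  proof (cases "i = j")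
    case True
    then show ?thesis using z by auto
  next
    case False
    then have "x = q j" using cells_meet assms z V_subset_SG by blast
    then show ?thesis using q_in_V0 V0_subset_V z by auto
  qed
qed

lemma SG_density:
  assumes "continuous_on SG f" "\<And>x r. x \<in> V r \<Longrightarrow> f x = (0::real)" "x \<in> SG"
  shows "f x = 0"
  using continuous_constant_on_closure[of Vstar f 0 x] assms
  by (auto simp: SG_eq_closure Vstar_def)

lemma dist_Fw: "dist (Fw w x) (Fw w y) = dist x y / 2 ^ length w"
  by (induction w) (auto simp: dist_F)

lemma continuous_Fw: "continuous_on A (Fw w)"
  by (induction w) (auto intro!: continuous_on_compose continuous_F simp del: id_apply o_apply)

lemma compact_cell: "compact (Fw w ` SG)"
  by (intro compact_continuous_image continuous_Fw compact_SG)

lemma words_subset: "w \<in> words r \<Longrightarrow> Fw w ` SG \<subseteq> SG"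
proof (induction r arbitrary: w)
  case (Suc r)
  then obtain i w' where "i < 3" "w' \<in> words r" "w = i # w'" by (auto simp: words_Suc)
  with Suc.IH[of w'] show ?case using F_in_SG by fastforce
qed auto

lemma SG_cells: "SG = (\<Union>w\<in>words r. Fw w ` SG)"
proof (induction r)
  case (Suc r)
  have "(\<Union>w\<in>words (Suc r). Fw w ` SG) = (\<Union>i<3. F i ` (\<Union>w\<in>words r. Fw w ` SG))"
    by (auto simp: words_Suc)
  then show ?case
    using SG_self_similar Suc.IH by simp
qed simp

text \<open>An r-cell has diameter at most \<open>B / 2 ^ r\<close>, where \<open>B\<close> bounds
  the diameter of \<open>SG\<close>. The cell need not be a neighbourhood of \<open>x\<close>: later
  uses need only its positive mass or a bump supported in it.\<close>

lemma small_cell: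
  assumes "open U" "x \<in> U" "x \<in> SG"
  obtains r w where "w \<in> words r" "x \<in> Fw w ` SG" "Fw w ` SG \<subseteq> U"
proof -
  obtain e where e: "e > 0" "ball x e \<subseteq> U"
    using assms openE by blast
  obtain B where B: "\<And>y z. y \<in> SG \<Longrightarrow> z \<in> SG \<Longrightarrow> dist y z \<le> B"
    using compact_imp_bounded[OF compact_SG] by (meson bounded_two_points)
  obtain r where r: "B / e < 2 ^ r"
    using real_arch_pow[of 2 "B / e"] by auto
  obtain w where w: "w \<in> words r" "x \<in> Fw w ` SG"
    using assms(3) SG_cells[of r] by blast
  have "Fw w ` SG \<subseteq> ball x e"
  proof
    fix y assume "y \<in> Fw w ` SG"
    then have "dist x y \<le> B / 2 ^ r"
      using w B by (auto simp: dist_Fw words_def divide_right_mono)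
    also have "\<dots> < e" using r e by (simp add: field_simps)
    finally show "y \<in> ball x e" by simp
  qed
  with e w show ?thesis by (intro that) auto
qed

section \<open>Energy\<close>

definition bdry_energy :: "(plane \<Rightarrow> real) \<Rightarrow> (plane \<Rightarrow> real) \<Rightarrow> real" where
  "bdry_energy u v = (u (q 0) - u (q 1)) * (v (q 0) - v (q 1))
     + (u (q 1) - u (q 2)) * (v (q 1) - v (q 2)) + (u (q 2) - u (q 0)) * (v (q 2) - v (q 0))"

lemma q_distinct: "q 0 \<noteq> q 1" "q 1 \<noteq> q 2" "q 0 \<noteq> q 2"
  using bary_q[of 0 0] bary_q[of 1 0] bary_q[of 1 1] bary_q[of 2 1] bary_q[of 2 0]
  by (auto simp del: One_nat_def)

lemma adj_0: "{(x, y). adj 0 x y} =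
  {(q 0, q 1), (q 1, q 0), (q 1, q 2), (q 2, q 1), (q 0, q 2), (q 2, q 0)}"
  using q_distinct q_distinct[symmetric] q_in_SG[of 0] q_in_SG[of 1] q_in_SG[of 2]
  by (auto simp: adj_def V0_def lessThan_3 simp del: One_nat_def)

lemma graph_energy_0: "graph_energy 0 u v = bdry_energy u v"
  using q_distinct q_distinct[symmetric]
  by (simp add: graph_energy_def adj_0 bdry_energy_def algebra_simps del: One_nat_def)

lemma adj_in_SG: "adj r x y \<Longrightarrow> x \<in> SG \<and> y \<in> SG"
  using V_subset_SG by (auto simp: adj_def)

text \<open>Every cell of level \<open>Suc r\<close> lies in a single 1-cell, so no edge joins two
  different 1-cells. This is the combinatorial source of the self-similarity of the energy.\<close>

lemma adj_Suc: "adj (Suc r) x y \<longleftrightarrow> (\<exists>i<3. \<exists>x' y'. x = F i x' \<and> y = F i y' \<and> adj r x' y')"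
proof
  assume adj: "adj (Suc r) x y"
  then obtain i w where w: "i < 3" "w \<in> words r" "x \<in> F i ` Fw w ` SG" "y \<in> F i ` Fw w ` SG"
    by (auto simp: adj_def words_Suc image_comp)
  then obtain x' y' where x': "x = F i x'" "x' \<in> Fw w ` SG" and y': "y = F i y'" "y' \<in> Fw w ` SG"
    by blast
  have "x' \<in> V r" "y' \<in> V r"
    using F_in_V_Suc[OF w(1)] adj x' y' words_subset[OF w(2)] by (auto simp: adj_def)
  then have "adj r x' y'"
    using adj x' y' w by (auto simp: adj_def)
  then show "\<exists>i<3. \<exists>x' y'. x = F i x' \<and> y = F i y' \<and> adj r x' y'"
    using w x' y' by blast
next
  assume "\<exists>i<3. \<exists>x' y'. x = F i x' \<and> y = F i y' \<and> adj r x' y'"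
  then obtain i x' y' where i: "i < 3" "x = F i x'" "y = F i y'" "adj r x' y'" by blast
  then obtain w where w: "w \<in> words r" "x' \<in> Fw w ` SG" "y' \<in> Fw w ` SG"
    by (auto simp: adj_def)
  have "i # w \<in> words (Suc r)" "x \<in> Fw (i # w) ` SG" "y \<in> Fw (i # w) ` SG"
    using i w by (auto simp: words_Suc)
  moreover have "x \<in> V (Suc r)" "y \<in> V (Suc r)" "x \<noteq> y"
    using i by (auto simp: V_Suc adj_def)
  ultimately show "adj (Suc r) x y" unfolding adj_def by blast
qed

lemma finite_adj: "finite {(x, y). adj r x y}"
  by (rule finite_subset[of _ "V r \<times> V r"]) (auto simp: adj_def finite_V)

lemma graph_energy_Suc:
  "graph_energy (Suc r) u v = 5/3 * (\<Sum>i<3. graph_energy r (u \<circ> F i) (v \<circ> F i))"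
proof -
  let ?D = "\<lambda>(x, y). (u x - u y) * (v x - v y)"
  let ?A = "{(x, y). adj r x y}"
  have "{(x, y). adj (Suc r) x y} = (\<Union>i<3. map_prod (F i) (F i) ` ?A)"
    unfolding adj_Suc by (auto simp: image_iff)
  moreover have "sum ?D (\<Union>i<3. map_prod (F i) (F i) ` ?A) =
      (\<Sum>i<3. sum ?D (map_prod (F i) (F i) ` ?A))"
  proof (rule sum.UNION_disjoint)
    show "\<forall>i\<in>{..<3}. \<forall>j\<in>{..<3}. i \<noteq> j \<longrightarrow>
      map_prod (F i) (F i) ` ?A \<inter> map_prod (F j) (F j) ` ?A = {}"
    proof (intro ballI impI)
      fix i j :: nat assume ij: "i \<in> {..<3}" "j \<in> {..<3}" "i \<noteq> j"
      \<comment> \<open>An edge lying in two 1-cells would have both endpoints at their single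
        common point.\<close>
      have False if "F i x = F j x'" "F i y = F j y'" "adj r x y" "adj r x' y'" for x y x' y'
      proof -
        have "x = q j" "y = q j"
          using that ij adj_in_SG cells_meet by blast+
        then show False using that by (simp add: adj_def)
      qed
      then show "map_prod (F i) (F i) ` ?A \<inter> map_prod (F j) (F j) ` ?A = {}"
        by auto
    qed
  qed (use finite_adj in auto)
  moreover have "sum ?D (map_prod (F i) (F i) ` ?A) =
      (\<Sum>(x, y)\<in>?A. ((u \<circ> F i) x - (u \<circ> F i) y) * ((v \<circ> F i) x - (v \<circ> F i) y))" for i
    by (subst sum.reindex) (auto simp: inj_on_def case_prod_unfold)
  ultimately show ?thesis
    by (simp add: graph_energy_def sum_distrib_left mult.assoc)
qed

declare graph_energy_Suc [simp] graph_energy_0 [simp]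

lemma graph_energy_cong:
  assumes "\<And>x. x \<in> V r \<Longrightarrow> u x = u' x" "\<And>x. x \<in> V r \<Longrightarrow> v x = v' x"
  shows "graph_energy r u v = graph_energy r u' v'"
  unfolding graph_energy_def
  by (intro arg_cong2[where f = "(*)"] refl sum.cong) (auto simp: adj_def assms)

lemma graph_energy_sym: "graph_energy r u v = graph_energy r v u"
  by (simp add: graph_energy_def mult.commute)

lemma graph_energy_lincomb_left:
  "graph_energy r (\<lambda>x. a * u x + b * u' x) v = a * graph_energy r u v + b * graph_energy r u' v"
  unfolding graph_energy_def
  by (simp add: case_prod_unfold sum_distrib_left algebra_simps flip: sum.distrib sum_subtractf)

section \<open>Monotone graph energies and the energy domain\<close>

lemma graph_energy_nonneg: "graph_energy r u u \<ge> 0"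
  unfolding graph_energy_def by (intro mult_nonneg_nonneg sum_nonneg) auto

text \<open>The constant 5/3 is the smallest for which energies increase under refinement: three unit
  resistors in a triangle, subdivided, are equivalent to resistors 5/3.\<close>

lemma graph_energy_0_le: "graph_energy 0 u u \<le> graph_energy (Suc 0) u u"
proof -
  have *: "(a - b)\<^sup>2 + (b - c)\<^sup>2 + (c - a)\<^sup>2 \<le> 5/3 * (((a - z)\<^sup>2 + (z - y)\<^sup>2 + (y - a)\<^sup>2)
    + ((z - b)\<^sup>2 + (b - x)\<^sup>2 + (x - z)\<^sup>2) + ((y - x)\<^sup>2 + (x - c)\<^sup>2 + (c - y)\<^sup>2))" (is "?l \<le> ?r")
    for a b c x y z :: real
  proof -
    \<comment> \<open>\<open>X\<close>, \<open>Y\<close>, \<open>Z\<close> measure the deviation of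
      the midpoint values from the minimizing ones, which weigh adjacent corners by 2/5 and the
      opposite one by 1/5. In these variables the difference is a sum of squares.\<close>
    define X where "X = x - (a + 2 * b + 2 * c) / 5"
    define Y where "Y = y - (2 * a + b + 2 * c) / 5"
    define Z where "Z = z - (2 * a + 2 * b + c) / 5"
    have "?r - ?l = 5/3 * ((X - Y)\<^sup>2 + (Y - Z)\<^sup>2 + (Z - X)\<^sup>2 + 2 * (X\<^sup>2 + Y\<^sup>2 + Z\<^sup>2))"
      unfolding X_def Y_def Z_def by (simp add: field_simps power2_eq_square)
    also have "\<dots> \<ge> 0" by simp
    finally show ?thesis by simp
  qed
  show ?thesis
    using *[of "u (q 0)" "u (q 1)" "u (q 2)" "u (F 0 (q 1))" "u (F 0 (q 2))" "u (F 1 (q 2))"]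
      F_q_swap[of 1 0] F_q_swap[of 2 0] F_q_swap[of 2 1]
    by (simp add: bdry_energy_def lessThan_3 power2_eq_square del: One_nat_def)
qed

lemma graph_energy_mono_Suc: "graph_energy r u u \<le> graph_energy (Suc r) u u"
proof (induction r arbitrary: u)
  case 0
  show ?case by (rule graph_energy_0_le)
next
  case (Suc r)
  show ?case
    unfolding graph_energy_Suc[of "Suc r"] graph_energy_Suc[of r u]
    using Suc.IH by (intro mult_left_mono sum_mono) auto
qed

lemma incseq_graph_energy: "incseq (\<lambda>r. graph_energy r u u)"
  by (rule incseq_SucI) (rule graph_energy_mono_Suc)

lemma dom_energyI:
  assumes "continuous_on SG u" "\<And>r. graph_energy r u u \<le> B"
  shows "u \<in> dom_energy"
proof -
  obtain L where "(\<lambda>r. graph_energy r u u) \<longlonglongrightarrow> L"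
    using incseq_convergent[OF incseq_graph_energy, of u B] assms(2) by blast
  then show ?thesis
    using assms(1) by (auto simp: dom_energy_def convergent_def)
qed

lemma dom_energy_continuous: "u \<in> dom_energy \<Longrightarrow> continuous_on SG u"
  by (simp add: dom_energy_def)

lemma dom_energy_tendsto: "u \<in> dom_energy \<Longrightarrow> (\<lambda>r. graph_energy r u u) \<longlonglongrightarrow> energy u u"
  by (simp add: dom_energy_def energy_def convergent_LIMSEQ_iff)

lemma graph_energy_le_energy: "u \<in> dom_energy \<Longrightarrow> graph_energy r u u \<le> energy u u"
  using incseq_le[OF incseq_graph_energy dom_energy_tendsto] .

text \<open>Parallelogram identity, with the nonnegative energy of \<open>a * u - b * v\<close>
  dropped.\<close>

lemma graph_energy_lincomb_le:
  "graph_energy r (\<lambda>x. a * u x + b * v x) (\<lambda>x. a * u x + b * v x)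
     \<le> 2 * (a\<^sup>2 * graph_energy r u u + b\<^sup>2 * graph_energy r v v)"
proof -
  let ?w = "\<lambda>c. \<lambda>x. a * u x + c * v x"
  have e: "graph_energy r (?w c) (?w c) =
      a\<^sup>2 * graph_energy r u u + c * (2 * a * graph_energy r u v) + c\<^sup>2 * graph_energy r v v" for c
    by (simp only: graph_energy_lincomb_left graph_energy_sym[of r _ "?w c"])
      (simp add: graph_energy_lincomb_left graph_energy_sym[of r v u] power2_eq_square algebra_simps
        del: graph_energy_Suc)
  show ?thesis
    using graph_energy_nonneg[of r "?w (-b)"] unfolding e by (simp add: algebra_simps)
qed

lemma dom_energy_lincomb:
  assumes "u \<in> dom_energy" "v \<in> dom_energy"
  shows "(\<lambda>x. a * u x + b * v x) \<in> dom_energy"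
proof (rule dom_energyI)
  show "continuous_on SG (\<lambda>x. a * u x + b * v x)"
    by (intro continuous_intros dom_energy_continuous assms)
  show "graph_energy r (\<lambda>x. a * u x + b * v x) (\<lambda>x. a * u x + b * v x)
     \<le> 2 * (a\<^sup>2 * energy u u + b\<^sup>2 * energy v v)" for r
    using graph_energy_lincomb_le[of r a u b v] graph_energy_le_energy[OF assms(1), of r]
      graph_energy_le_energy[OF assms(2), of r]
    by (smt (verit) mult_left_mono zero_le_power2)
qed

text \<open>Monotonicity yields convergence only on the diagonal, and \<open>lim\<close> carries no
  information without convergence; polarization transfers it to mixed energies.\<close>

lemma energy_tendsto:
  assumes "u \<in> dom_energy" "v \<in> dom_energy"
  shows "(\<lambda>r. graph_energy r u v) \<longlonglongrightarrow> energy u v"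
proof -
  \<comment> \<open>The factor \<open>1 *\<close> puts sum and difference literally into the form of
    the linear combination lemmas; the same device recurs below.\<close>
  let ?w = "\<lambda>c x. 1 * u x + c * v x"
  have "graph_energy r u v = (graph_energy r (?w 1) (?w 1) - graph_energy r (?w (-1)) (?w (-1))) / 4"
    (is "_ = ?d r") for r
    by (simp only: graph_energy_lincomb_left graph_energy_sym[of r _ "?w _"])
      (simp add: graph_energy_lincomb_left graph_energy_sym[of r v u] del: graph_energy_Suc)
  then have "(\<lambda>r. graph_energy r u v) = ?d"
    by (rule ext)
  moreover have "?d
      \<longlonglongrightarrow> (energy (?w 1) (?w 1) - energy (?w (-1)) (?w (-1))) / 4"
    by (intro tendsto_intros dom_energy_tendsto dom_energy_lincomb assms) simp
  ultimately have "convergent (\<lambda>r. graph_energy r u v)"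
    unfolding convergent_def by metis
  then show ?thesis by (simp add: energy_def convergent_LIMSEQ_iff)
qed

lemma energy_lincomb_left:
  assumes "u \<in> dom_energy" "u' \<in> dom_energy" "v \<in> dom_energy"
  shows "energy (\<lambda>x. a * u x + b * u' x) v = a * energy u v + b * energy u' v"
proof (rule LIMSEQ_unique)
  show "(\<lambda>r. graph_energy r (\<lambda>x. a * u x + b * u' x) v) \<longlonglongrightarrow> energy (\<lambda>x. a * u x + b * u' x) v"
    by (intro energy_tendsto dom_energy_lincomb assms)
  show "(\<lambda>r. graph_energy r (\<lambda>x. a * u x + b * u' x) v) \<longlonglongrightarrow> a * energy u v + b * energy u' v"
    unfolding graph_energy_lincomb_left by (intro tendsto_intros energy_tendsto assms)
qed

lemma energy_sym: "energy u v = energy v u"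
  by (simp add: energy_def graph_energy_sym[of _ u v])

lemma energy_cong:
  assumes "\<And>x. x \<in> SG \<Longrightarrow> u x = u' x" "\<And>x. x \<in> SG \<Longrightarrow> v x = v' x"
  shows "energy u v = energy u' v'"
  unfolding energy_def
  using graph_energy_cong[of _ u u' v v'] assms V_subset_SG by (metis subset_iff)

lemma dom_energy_cong:
  assumes "\<And>x. x \<in> SG \<Longrightarrow> u x = u' x"
  shows "u \<in> dom_energy \<longleftrightarrow> u' \<in> dom_energy"
proof -
  have "graph_energy r u u = graph_energy r u' u'" for r
    using assms V_subset_SG by (intro graph_energy_cong) blast+
  then show ?thesis
    using continuous_on_cong[OF refl, of SG u u'] assms by (simp add: dom_energy_def)
qed

text \<open>Discrete Leibniz rule on each edge, with both factors bounded on the compact set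
  \<open>SG\<close>. Products are needed to build bumps, since harmonic functions alone do not
  vanish on the boundary unless trivial.\<close>

lemma dom_energy_mult:
  assumes "u \<in> dom_energy" "v \<in> dom_energy"
  shows "(\<lambda>x. u x * v x) \<in> dom_energy"
proof -
  obtain B where B: "B \<ge> 0" "\<And>x. x \<in> SG \<Longrightarrow> \<bar>u x\<bar> \<le> B" "\<And>x. x \<in> SG \<Longrightarrow> \<bar>v x\<bar> \<le> B"
  proof -
    have "bounded (u ` SG \<union> v ` SG)"
      using assms by (auto intro!: compact_imp_bounded compact_continuous_image compact_SG
        dom_energy_continuous)
    then obtain B where "\<And>x. x \<in> SG \<Longrightarrow> \<bar>u x\<bar> \<le> B \<and> \<bar>v x\<bar> \<le> B"
      by (auto simp: bounded_iff)
    then show thesis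
      using that[of "\<bar>B\<bar>"] by force
  qed
  show ?thesis
  proof (rule dom_energyI)
    show "continuous_on SG (\<lambda>x. u x * v x)"
      by (intro continuous_intros dom_energy_continuous assms)
    fix r
    have pt: "(u x * v x - u y * v y) * (u x * v x - u y * v y)
        \<le> 2 * B\<^sup>2 * ((u x - u y) * (u x - u y)) + 2 * B\<^sup>2 * ((v x - v y) * (v x - v y))"
      if "adj r x y" for x y
    proof -
      have "(u x * v x - u y * v y) = (u x - u y) * v x + u y * (v x - v y)"
        by (simp add: algebra_simps)
      then have "(u x * v x - u y * v y)\<^sup>2 \<le> 2 * ((u x - u y) * v x)\<^sup>2 + 2 * (u y * (v x - v y))\<^sup>2"
        using sum_squares_bound[of "(u x - u y) * v x" "u y * (v x - v y)"]
        by (simp add: power2_sum)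
      moreover have "(v x)\<^sup>2 \<le> B\<^sup>2" "(u y)\<^sup>2 \<le> B\<^sup>2"
        using B adj_in_SG[OF that] by (auto simp: abs_le_square_iff[symmetric])
      then have "(v x)\<^sup>2 * (u x - u y)\<^sup>2 \<le> B\<^sup>2 * (u x - u y)\<^sup>2" "(u y)\<^sup>2 * (v x - v y)\<^sup>2 \<le> B\<^sup>2 * (v x - v y)\<^sup>2"
        by (auto intro: mult_right_mono)
      ultimately show ?thesis by (simp add: power2_eq_square algebra_simps)
    qed
    have "graph_energy r (\<lambda>x. u x * v x) (\<lambda>x. u x * v x)
      \<le> (5/3) ^ r * ((1/2) * (\<Sum>(x, y)\<in>{(x, y). adj r x y}. 2 * B\<^sup>2 * ((u x - u y) * (u x - u y))
            + 2 * B\<^sup>2 * ((v x - v y) * (v x - v y))))"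
      unfolding graph_energy_def
      by (intro mult_left_mono sum_mono) (auto intro: pt)
    also have "\<dots> = 2 * B\<^sup>2 * graph_energy r u u + 2 * B\<^sup>2 * graph_energy r v v"
      by (simp add: graph_energy_def case_prod_unfold sum.distrib flip: sum_distrib_left)
        (simp add: algebra_simps)
    also have "\<dots> \<le> 2 * B\<^sup>2 * energy u u + 2 * B\<^sup>2 * energy v v"
      by (intro add_mono mult_left_mono graph_energy_le_energy assms) auto
    finally show "graph_energy r (\<lambda>x. u x * v x) (\<lambda>x. u x * v x)
      \<le> 2 * B\<^sup>2 * energy u u + 2 * B\<^sup>2 * energy v v" .
  qed
qed

text \<open>Zero energy passes to each 1-cell, so \<open>u\<close> is constant there by induction.
  The 1-cell of index \<open>i\<close> contains \<open>q i\<close>, as the fixed point of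
  \<open>F i\<close>, and the level-0 energy forces equal values at the three corners.\<close>

lemma energy_zero_constant:
  assumes "\<And>r. graph_energy r u u = 0" "x \<in> V r"
  shows "u x = u (q 0)"
  using assms
proof (induction r arbitrary: u x)
  case 0
  then have "bdry_energy u u = 0" using graph_energy_0 by metis
  then have "u (q 0) = u (q 1) \<and> u (q 1) = u (q 2)"
    by (simp add: bdry_energy_def) (smt (verit) mult_eq_0_iff zero_le_square)
  with 0 show ?case by (auto simp: V0_def lessThan_3)
next
  case (Suc r)
  have c: "u (F i y) = u (F i (q 0))" if "i < 3" "y \<in> V s" "s = 0 \<or> s = r" for i y s
  proof -
    have "graph_energy s (u \<circ> F i) (u \<circ> F i) = 0" for s
    proof -
      have "(\<Sum>i<3. graph_energy s (u \<circ> F i) (u \<circ> F i)) = 0"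
        using Suc.prems(1)[of "Suc s"] by simp
      then show ?thesis
        using that(1) by (subst (asm) sum_nonneg_eq_0_iff) (auto intro: graph_energy_nonneg)
    qed
    moreover have "y \<in> V r" using that V0_subset_V[of r] by auto
    ultimately show ?thesis using Suc.IH[of "u \<circ> F i" y] by (simp add: o_def)
  qed
  have "bdry_energy u u = 0" using Suc.prems(1)[of 0] by simp
  then have "u (q 0) = u (q 1) \<and> u (q 1) = u (q 2)"
    by (simp add: bdry_energy_def) (smt (verit) mult_eq_0_iff zero_le_square)
  then have u: "u (q i) = u (q 0)" if "i < 3" for i
    using that by (auto simp: less_3_iff)
  obtain i y where y: "i < 3" "y \<in> V r" "x = F i y"
    using Suc.prems(2) by (auto simp: V_Suc)
  then show ?case
    using c[of i y r] c[of i "q i" 0] u[of i] q_in_V0[of i] by simp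
qed

lemma energy_zero_eq_zero:
  assumes "u \<in> dom_energy" "energy u u = 0" "\<And>x. x \<in> V0 \<Longrightarrow> u x = 0" "x \<in> SG"
  shows "u x = 0"
proof (rule SG_density[OF dom_energy_continuous[OF assms(1)] _ assms(4)])
  have "graph_energy r u u = 0" for r
    using graph_energy_le_energy[OF assms(1), of r] graph_energy_nonneg[of r u] assms(2) by simp
  then have "u x = u (q 0)" if "x \<in> V r" for x r
    by (rule energy_zero_constant) (fact that)
  then show "u x = 0" if "x \<in> V r" for x r
    using that assms(3) q_in_V0[of 0] by simp
qed

section \<open>Gluing functions along 1-cells\<close>

definition Finv :: "nat \<Rightarrow> plane \<Rightarrow> plane" where
  "Finv i y = 2 *\<^sub>R y - q i"

lemma Finv_F [simp]: "Finv i (F i x) = x"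
  by (simp add: Finv_def F_alt scaleR_add_right)

lemma continuous_Finv: "continuous_on A (Finv i)"
  unfolding Finv_def by (intro continuous_intros)

text \<open>Pasting over three closed cells. No compatibility condition appears, because
  \<open>g\<close> is already one function on the plane.\<close>

lemma continuous_on_SG_glue:
  assumes "\<And>i. i < 3 \<Longrightarrow> continuous_on SG (\<lambda>x. g (F i x))"
  shows "continuous_on SG g"
proof -
  have "continuous_on (F i ` SG) g" if "i < 3" for i
  proof -
    have "continuous_on (F i ` SG) (\<lambda>y. g (F i (Finv i y)))"
      by (rule continuous_on_compose2[OF assms[OF that], of _ "Finv i"])
        (auto intro: continuous_Finv)
    then show ?thesis
      by (rule continuous_on_eq) auto
  qed
  moreover have "closed (F i ` SG)" for i
    by (intro compact_imp_closed compact_continuous_image continuous_F compact_SG)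
  ultimately have "continuous_on (F 0 ` SG \<union> F 1 ` SG \<union> F 2 ` SG) g"
    by (intro continuous_on_closed_Un closed_Un) auto
  moreover have "F 0 ` SG \<union> F 1 ` SG \<union> F 2 ` SG = SG"
    by (subst (4) SG_self_similar) (auto simp: lessThan_3)
  ultimately show ?thesis by simp
qed

lemma SG_cases:
  assumes "x \<in> SG"
  obtains i y where "i < 3" "y \<in> SG" "x = F i y"
  using assms SG_self_similar by blast

section \<open>Harmonic functions\<close>

text \<open>The values at \<open>F i (q j)\<close> of the harmonic function with boundary values \<open>a\<close>: the
  value at the midpoint of \<open>q i\<close> and \<open>q j\<close> weighs the adjacent corners by 2/5 and the opposite
  one by 1/5.\<close>

definition hstep :: "nat \<Rightarrow> (nat \<Rightarrow> real) \<Rightarrow> nat \<Rightarrow> real" where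
  "hstep i a j = (if i = j then a i else (a 0 + a 1 + a 2 + a i + a j) / 5)"

text \<open>On each n-cell this is the affine interpolation of the harmonic values at its corners.
  \<open>LEAST\<close> merely selects a cell for points lying in two of them.\<close>

primrec harm_approx :: "nat \<Rightarrow> (nat \<Rightarrow> real) \<Rightarrow> plane \<Rightarrow> real" where
  "harm_approx 0 a x = (\<Sum>i<3. a i * bary i x)"
| "harm_approx (Suc n) a x =
     (let i = LEAST i. i < 3 \<and> x \<in> F i ` SG in harm_approx n (hstep i a) (Finv i x))"

lemma hstep_swap: "hstep i a j = hstep j a i"
  by (simp add: hstep_def)

text \<open>The cell selected by \<open>LEAST\<close> does not matter: at a shared corner both cells
  prescribe the same value, since \<open>hstep\<close> is symmetric in its indices. The corner
  values are a hypothesis because \<open>harm_approx_q\<close> is itself proved by an induction that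
  uses this fact.\<close>

lemma harm_approx_Suc_aux:
  assumes "i < 3" "x \<in> SG" "\<And>a j. j < 3 \<Longrightarrow> harm_approx n a (q j) = a j"
  shows "harm_approx (Suc n) a (F i x) = harm_approx n (hstep i a) x"
proof -
  define j where "j = (LEAST j. j < 3 \<and> F i x \<in> F j ` SG)"
  have "j < 3 \<and> F i x \<in> F j ` SG"
    unfolding j_def by (rule LeastI[of _ i]) (use assms in auto)
  then obtain y where j: "j < 3" "y \<in> SG" "F i x = F j y" by auto
  have eq: "harm_approx (Suc n) a (F i x) = harm_approx n (hstep j a) y"
    unfolding harm_approx.simps Let_def j_def[symmetric] using j by simp
  show ?thesis
  proof (cases "i = j")
    case True
    then show ?thesis using eq j by auto
  next
    case False
    have "x = q j" "y = q i"
      using cells_meet[of i j x y] cells_meet[of j i y x] assms j False by auto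
    then show ?thesis using eq assms j hstep_swap by simp
  qed
qed

lemma harm_approx_q: "j < 3 \<Longrightarrow> harm_approx n a (q j) = a j"
proof (induction n arbitrary: a j)
  case 0
  then show ?case by (auto simp: less_3_iff bary_q lessThan_3)
next
  case (Suc n)
  then show ?case
    using harm_approx_Suc_aux[of j "q j" n a] q_in_SG[of j] by (simp add: hstep_def)
qed

lemma harm_approx_Suc:
  "i < 3 \<Longrightarrow> x \<in> SG \<Longrightarrow> harm_approx (Suc n) a (F i x) = harm_approx n (hstep i a) x"
  by (rule harm_approx_Suc_aux) (auto simp: harm_approx_q)

lemma continuous_harm_approx: "continuous_on SG (harm_approx n a)"
proof (induction n arbitrary: a)
  case 0
  have "harm_approx 0 a = (\<lambda>x. \<Sum>i<3. a i * bary i x)" by (simp add: fun_eq_iff)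
  then show ?case by (auto intro!: continuous_intros)
next
  case (Suc n)
  show ?case
  proof (rule continuous_on_SG_glue)
    fix i :: nat assume "i < 3"
    then show "continuous_on SG (\<lambda>x. harm_approx (Suc n) a (F i x))"
      by (intro continuous_on_eq[OF Suc.IH[of "hstep i a"]]) (simp add: harm_approx_Suc del: harm_approx.simps)
  qed
qed

text \<open>Twice the difference of maximum and minimum, in a form free of case distinctions.
  Harmonic extension to a subcell contracts it by 3/5.\<close>

definition osc :: "(nat \<Rightarrow> real) \<Rightarrow> real" where
  "osc a = \<bar>a 0 - a 1\<bar> + \<bar>a 1 - a 2\<bar> + \<bar>a 2 - a 0\<bar>"

lemma osc_hstep: "i < 3 \<Longrightarrow> osc (hstep i a) \<le> 3/5 * osc a"
  by (auto simp: less_3_iff osc_def hstep_def field_simps abs_if)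

lemma harm_approx_0_close:
  assumes "x \<in> SG" "\<And>i. i < 3 \<Longrightarrow> \<bar>b i - c\<bar> \<le> B"
  shows "\<bar>harm_approx 0 b x - c\<bar> \<le> B"
proof -
  note nn = bary_SG_nonneg[OF assms(1)]
  have "B \<ge> 0" using assms(2)[of 0] by simp
  have "harm_approx 0 b x - c = (\<Sum>i<3. (b i - c) * bary i x)"
  proof -
    have "c = (\<Sum>i<3. c * bary i x)"
      using bary_sum[of x] by (simp add: lessThan_3 flip: distrib_left)
    then show ?thesis by (simp add: left_diff_distrib sum_subtractf)
  qed
  also have "\<bar>\<dots>\<bar> \<le> (\<Sum>i<3. B * bary i x)"
    by (rule order_trans[OF sum_abs sum_mono]) (use assms nn \<open>B \<ge> 0\<close> in \<open>auto simp: abs_mult intro!: mult_mono\<close>)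
  also have "\<dots> = B"
    using bary_sum[of x] by (simp add: lessThan_3 flip: distrib_left)
  finally show ?thesis .
qed

text \<open>At levels 0 and 1 both values stay within \<open>osc a\<close> of \<open>a 0\<close>,
  whence the constant 2. Each further level replaces \<open>a\<close> by \<open>hstep i a\<close>,
  which contributes a factor 3/5. The bound is summable and feeds the M-test for
  \<open>hfun\<close>.\<close>

lemma harm_approx_diff:
  "x \<in> SG \<Longrightarrow> \<bar>harm_approx (Suc n) a x - harm_approx n a x\<bar> \<le> 2 * osc a * (3/5) ^ n"
proof (induction n arbitrary: a x)
  case 0
  then obtain i y where i: "i < 3" "y \<in> SG" "x = F i y" using SG_cases by blast
  have "\<bar>harm_approx 0 (hstep i a) y - a 0\<bar> \<le> osc a"
    using i(1) by (intro harm_approx_0_close i(2)) (auto simp: less_3_iff osc_def hstep_def field_simps abs_if)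
  moreover have "\<bar>harm_approx 0 a x - a 0\<bar> \<le> osc a"
    by (intro harm_approx_0_close 0) (auto simp: less_3_iff osc_def)
  ultimately show ?case
    using harm_approx_Suc[OF i(1,2), of 0 a] i(3) by (simp del: harm_approx.simps)
next
  case (Suc n)
  then obtain i y where i: "i < 3" "y \<in> SG" "x = F i y" using SG_cases by blast
  have "\<bar>harm_approx (Suc (Suc n)) a x - harm_approx (Suc n) a x\<bar> \<le> 2 * osc (hstep i a) * (3/5) ^ n"
    using Suc.IH[OF i(2), of "hstep i a"] i by (simp add: harm_approx_Suc del: harm_approx.simps)
  also have "\<dots> \<le> 2 * (3/5 * osc a) * (3/5) ^ n"
    using osc_hstep[OF i(1)] by (intro mult_right_mono mult_left_mono) auto
  finally show ?case by (simp add: mult_ac)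
qed

definition hfun :: "(nat \<Rightarrow> real) \<Rightarrow> plane \<Rightarrow> real" where
  "hfun a x = lim (\<lambda>n. harm_approx n a x)"

lemma uniform_limit_hfun: "uniform_limit SG (\<lambda>n. harm_approx n a) (hfun a) sequentially"
proof -
  let ?d = "\<lambda>n x. harm_approx (Suc n) a x - harm_approx n a x"
  have "uniform_limit SG (\<lambda>n x. \<Sum>i<n. ?d i x) (\<lambda>x. suminf (\<lambda>i. ?d i x)) sequentially"
    by (rule Weierstrass_m_test[where M = "\<lambda>n. 2 * osc a * (3/5) ^ n"])
      (auto intro!: summable_mult summable_geometric harm_approx_diff simp del: harm_approx.simps)
  then have "uniform_limit SG (\<lambda>n x. harm_approx n a x - harm_approx 0 a x) (\<lambda>x. suminf (\<lambda>i. ?d i x)) sequentially"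
    by (simp only: sum_lessThan_telescope[where f = "\<lambda>n. harm_approx n a _"])
  then have "uniform_limit SG (\<lambda>n x. (harm_approx n a x - harm_approx 0 a x) + harm_approx 0 a x)
      (\<lambda>x. suminf (\<lambda>i. ?d i x) + harm_approx 0 a x) sequentially"
    by (intro uniform_limit_add uniform_limit_const)
  then have *: "uniform_limit SG (\<lambda>n x. harm_approx n a x)
      (\<lambda>x. suminf (\<lambda>i. ?d i x) + harm_approx 0 a x) sequentially"
    by simp
  have "suminf (\<lambda>i. ?d i x) + harm_approx 0 a x = hfun a x" if "x \<in> SG" for x
    using tendsto_uniform_limitI[OF * that] unfolding hfun_def by (rule limI[symmetric])
  then show ?thesis
    using uniform_limit_cong'[of SG "\<lambda>n. harm_approx n a" "\<lambda>n. harm_approx n a"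
        "\<lambda>x. suminf (\<lambda>i. ?d i x) + harm_approx 0 a x" "hfun a"] * by simp
qed

lemma hfun_tendsto: "x \<in> SG \<Longrightarrow> (\<lambda>n. harm_approx n a x) \<longlonglongrightarrow> hfun a x"
  using tendsto_uniform_limitI[OF uniform_limit_hfun] .

lemma continuous_hfun: "continuous_on SG (hfun a)"
  by (rule uniform_limit_theorem[OF _ uniform_limit_hfun]) (simp_all add: continuous_harm_approx)

lemma hfun_q: "j < 3 \<Longrightarrow> hfun a (q j) = a j"
  using hfun_tendsto[OF q_in_SG[of j], of a] by (simp add: harm_approx_q LIMSEQ_const_iff)

lemma hfun_F:
  assumes "i < 3" "x \<in> SG"
  shows "hfun a (F i x) = hfun (hstep i a) x"
proof (rule LIMSEQ_unique)
  show "(\<lambda>n. harm_approx (Suc n) a (F i x)) \<longlonglongrightarrow> hfun a (F i x)"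
    using hfun_tendsto[OF F_in_SG[OF assms]] by (rule LIMSEQ_Suc)
  show "(\<lambda>n. harm_approx (Suc n) a (F i x)) \<longlonglongrightarrow> hfun (hstep i a) x"
    using hfun_tendsto[OF assms(2)] unfolding harm_approx_Suc[OF assms] .
qed

text \<open>The weights in \<open>hstep\<close> solve the discrete Dirichlet problem on the
  subdivided triangle, so in one refinement the values of \<open>v\<close> at the midpoints cancel
  and 5/3 compensates exactly. With arbitrary \<open>v\<close> this gives at once finite energy and
  vanishing of the energy against test functions.\<close>

lemma graph_energy_hfun: "graph_energy r (hfun a) v = bdry_energy (hfun a) v"
proof (induction r arbitrary: a v)
  case 0
  show ?case by simp
next
  case (Suc r)
  have "graph_energy (Suc r) (hfun a) v = 5/3 * (\<Sum>i<3. graph_energy r (hfun (hstep i a)) (v \<circ> F i))"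
    unfolding graph_energy_Suc using V_subset_SG[of r]
    by (intro arg_cong2[where f = "(*)"] refl sum.cong graph_energy_cong) (auto simp: hfun_F)
  also have "\<dots> = 5/3 * (\<Sum>i<3. bdry_energy (hfun (hstep i a)) (v \<circ> F i))"
    by (simp only: Suc.IH)
  also have "\<dots> = bdry_energy (hfun a) v"
    using F_q_swap[of 1 0] F_q_swap[of 2 0] F_q_swap[of 2 1]
    by (simp add: bdry_energy_def lessThan_3 hfun_q hstep_def field_simps del: One_nat_def)
  finally show ?case .
qed

lemma hfun_dom_energy: "hfun a \<in> dom_energy"
  by (rule dom_energyI[OF continuous_hfun]) (auto simp: graph_energy_hfun)

lemma energy_hfun: "energy (hfun a) v = bdry_energy (hfun a) v"
  unfolding energy_def graph_energy_hfun by simp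

lemma energy_hfun_test:
  assumes "\<And>x. x \<in> V0 \<Longrightarrow> v x = 0"
  shows "energy (hfun a) v = 0"
  unfolding energy_hfun bdry_energy_def using assms by (simp add: q_in_V0)

text \<open>The two functionals are eigenvectors of harmonic restriction to the cell at
  \<open>q 0\<close>, with eigenvalues 3/5 and 1/5. This is where the factors
  \<open>(5/3) ^ r\<close> and \<open>5 ^ r\<close> of the normal and tangential derivatives come
  from; for harmonic functions both sequences are constant.\<close>

lemma hstep_iterate:
  "2 * (hstep 0 ^^ r) a 0 - (hstep 0 ^^ r) a 1 - (hstep 0 ^^ r) a 2 = (3/5) ^ r * (2 * a 0 - a 1 - a 2)"
  "(hstep 0 ^^ r) a 1 - (hstep 0 ^^ r) a 2 = (1/5) ^ r * (a 1 - a 2)"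
  by (induction r) (auto simp: hstep_def field_simps)

lemma iterate_F_in_SG: "i < 3 \<Longrightarrow> x \<in> SG \<Longrightarrow> (F i ^^ r) x \<in> SG"
  by (induction r) (auto intro: F_in_SG)

lemma hfun_iterate_F: "x \<in> SG \<Longrightarrow> hfun a ((F 0 ^^ r) x) = hfun ((hstep 0 ^^ r) a) x"
proof (induction r arbitrary: a)
  case (Suc r)
  then have "hfun a ((F 0 ^^ Suc r) x) = hfun (hstep 0 a) ((F 0 ^^ r) x)"
    using iterate_F_in_SG[of 0 x r] by (simp add: hfun_F)
  then show ?case using Suc by (simp add: funpow_swap1)
qed simp

lemma has_normal_deriv_0_iff: "has_normal_deriv u D 0 \<longleftrightarrow>
    (\<lambda>r. (5/3) ^ r * (2 * u (q 0) - u ((F 0 ^^ r) (q 1)) - u ((F 0 ^^ r) (q 2)))) \<longlonglongrightarrow> D"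
  by (simp add: has_normal_deriv_def numeral_2_eq_2)

lemma has_tangential_deriv_0_iff: "has_tangential_deriv u D 0 \<longleftrightarrow>
    (\<lambda>r. 5 ^ r * (u ((F 0 ^^ r) (q 1)) - u ((F 0 ^^ r) (q 2)))) \<longlonglongrightarrow> D"
  by (simp add: has_tangential_deriv_def numeral_2_eq_2)

lemma hfun_normal_deriv: "has_normal_deriv (hfun a) (2 * a 0 - a 1 - a 2) 0"
proof -
  have "(hstep 0 ^^ r) a 0 = a 0" for r by (induction r) (auto simp: hstep_def)
  then have "(5/3) ^ r * (2 * hfun a (q 0) - hfun a ((F 0 ^^ r) (q 1)) - hfun a ((F 0 ^^ r) (q 2)))
      = 2 * a 0 - a 1 - a 2" for r
    using hstep_iterate(1)[of r a]
    by (simp add: hfun_iterate_F q_in_SG hfun_q del: One_nat_def)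
      (simp flip: mult.assoc power_mult_distrib)
  then show ?thesis by (simp add: has_normal_deriv_0_iff del: One_nat_def)
qed

lemma hfun_tangential_deriv: "has_tangential_deriv (hfun a) (a 1 - a 2) 0"
proof -
  have "5 ^ r * (hfun a ((F 0 ^^ r) (q 1)) - hfun a ((F 0 ^^ r) (q 2))) = a 1 - a 2" for r
    using hstep_iterate(2)[of r a]
    by (simp add: hfun_iterate_F q_in_SG hfun_q del: One_nat_def)
      (simp flip: mult.assoc power_mult_distrib)
  then show ?thesis by (simp add: has_tangential_deriv_0_iff del: One_nat_def)
qed

section \<open>Bump functions\<close>

definition plant :: "nat \<Rightarrow> (plane \<Rightarrow> real) \<Rightarrow> plane \<Rightarrow> real" where
  "plant i u y = (if y \<in> F i ` SG then u (Finv i y) else 0)"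

text \<open>At a point shared by two cells the planted copy is evaluated at a corner, where
  \<open>u\<close> vanishes. Extension by zero is therefore consistent.\<close>

lemma plant_F:
  assumes "i < 3" "j < 3" "x \<in> SG" "\<And>x. x \<in> V0 \<Longrightarrow> u x = 0"
  shows "plant i u (F j x) = (if i = j then u x else 0)"
proof (cases "i = j \<or> F j x \<notin> F i ` SG")
  case True
  then show ?thesis using assms by (auto simp: plant_def)
next
  case False
  then obtain y where y: "y \<in> SG" "F j x = F i y" by auto
  then have "y = q j" using cells_meet[of i j y x] assms False by auto
  then show ?thesis using y assms False q_in_V0[of j] by (simp add: plant_def)
qed

lemma plant_dom_energy:
  assumes "i < 3" "u \<in> dom_energy" "\<And>x. x \<in> V0 \<Longrightarrow> u x = 0"
  shows "plant i u \<in> dom_energy" "\<And>x. x \<in> V0 \<Longrightarrow> plant i u x = 0"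
proof -
  note pF = plant_F[OF assms(1) _ _ assms(3)]
  show "plant i u x = 0" if "x \<in> V0" for x
  proof -
    from that obtain j where j: "j < 3" "x = q j" by (auto simp: V0_def)
    then show ?thesis using pF[of j "q j"] assms(3)[OF that] q_in_SG[of j] by simp
  qed
  show "plant i u \<in> dom_energy"
  proof (rule dom_energyI)
    show "continuous_on SG (plant i u)"
    proof (rule continuous_on_SG_glue)
      fix j :: nat assume j: "j < 3"
      have "continuous_on SG (\<lambda>x. if i = j then u x else 0)"
        using dom_energy_continuous[OF assms(2)] by (cases "i = j") simp_all
      then show "continuous_on SG (\<lambda>x. plant i u (F j x))"
        by (rule continuous_on_eq) (use j pF in simp)
    qed
    fix r
    have "0 \<le> energy u u"
      using graph_energy_nonneg[of 0 u] graph_energy_le_energy[OF assms(2), of 0] by linarith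
    show "graph_energy r (plant i u) (plant i u) \<le> 5/3 * energy u u"
    \<comment> \<open>Passing to level \<open>Suc r\<close> makes the splitting over 1-cells
      applicable, level 0 included; only cell \<open>i\<close> contributes.\<close>
    proof (rule order_trans[OF graph_energy_mono_Suc])
      have "graph_energy (Suc r) (plant i u) (plant i u) = 5/3 * (\<Sum>j<3. if i = j then graph_energy r u u else 0)"
        unfolding graph_energy_Suc
      proof (intro arg_cong2[where f = "(*)"] refl sum.cong)
        fix j :: nat assume "j \<in> {..<3}"
        then have "graph_energy r (plant i u \<circ> F j) (plant i u \<circ> F j) =
            graph_energy r (\<lambda>x. if i = j then u x else 0) (\<lambda>x. if i = j then u x else 0)"
          using V_subset_SG[of r] by (intro graph_energy_cong) (simp_all add: subset_iff pF)
        then show "graph_energy r (plant i u \<circ> F j) (plant i u \<circ> F j) = (if i = j then graph_energy r u u else 0)"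
          by (auto simp: graph_energy_def)
      qed
      also have "\<dots> = 5/3 * graph_energy r u u" using assms(1) by simp
      also have "\<dots> \<le> 5/3 * energy u u" using graph_energy_le_energy[OF assms(2), of r] by simp
      finally show "graph_energy (Suc r) (plant i u) (plant i u) \<le> 5/3 * energy u u" .
    qed
  qed
qed

lemma bump_exists:
  assumes "w \<in> words r"
  obtains v z where "v \<in> dom_energy" "\<And>x. x \<in> V0 \<Longrightarrow> v x = 0" "\<And>x. x \<in> SG \<Longrightarrow> v x \<ge> 0"
    "\<And>x. x \<in> SG \<Longrightarrow> x \<notin> Fw w ` SG \<Longrightarrow> v x = 0" "z \<in> Fw w ` SG" "v z > 0"
proof -
  have "\<exists>v\<in>dom_energy. (\<forall>x\<in>V0. v x = 0) \<and> (\<forall>x\<in>SG. v x \<ge> 0) \<and>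
      (\<forall>x\<in>SG. x \<notin> Fw w ` SG \<longrightarrow> v x = 0) \<and> (\<exists>z\<in>Fw w ` SG. v z > 0)"
    using assms
  proof (induction r arbitrary: w)
    case 0
    \<comment> \<open>Each corner is a zero of one of the two harmonic factors, while both equal 2/5
      at the midpoint of \<open>q 0\<close> and \<open>q 1\<close>. Squaring gives nonnegativity
      without a maximum principle.\<close>
    define b where "b x = hfun (\<lambda>j. of_bool (j = 0)) x * hfun (\<lambda>j. of_bool (j = 1)) x" for x
    have b: "b \<in> dom_energy"
      unfolding b_def by (intro dom_energy_mult hfun_dom_energy)
    have "(\<lambda>x. b x * b x) \<in> dom_energy" by (intro dom_energy_mult b)
    moreover have "\<forall>x\<in>V0. b x * b x = 0"
      by (auto simp: b_def V0_def less_3_iff hfun_q)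
    moreover have "F 0 (q 1) \<in> SG" "b (F 0 (q 1)) \<noteq> 0"
      by (simp_all add: b_def hfun_F q_in_SG hfun_q hstep_def F_in_SG del: One_nat_def)
    then have "\<exists>z\<in>SG. b z * b z > 0"
      by (intro bexI[of _ "F 0 (q 1)"]) (auto simp: zero_less_mult_iff simp del: One_nat_def)
    ultimately show ?case using 0 by (intro bexI[of _ "\<lambda>x. b x * b x"]) auto
  next
    case (Suc r)
    then obtain i w' where w: "i < 3" "w' \<in> words r" "w = i # w'" by (auto simp: words_Suc)
    from Suc.IH[OF w(2)] obtain v z where v: "v \<in> dom_energy" "\<And>x. x \<in> V0 \<Longrightarrow> v x = 0"
      "\<And>x. x \<in> SG \<Longrightarrow> v x \<ge> 0" "\<And>x. x \<in> SG \<Longrightarrow> x \<notin> Fw w' ` SG \<Longrightarrow> v x = 0" "z \<in> Fw w' ` SG" "v z > 0"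
      by blast
    note p = plant_dom_energy[OF w(1) v(1,2)] plant_F[OF w(1) _ _ v(2)]
    have "z \<in> SG" using v(5) words_subset[OF w(2)] by blast
    show ?case
    proof (intro bexI[OF _ p(1)] conjI ballI impI)
      fix x assume x: "x \<in> SG"
      then obtain j y where y: "j < 3" "y \<in> SG" "x = F j y" using SG_cases by blast
      show "plant i v x \<ge> 0" using y p(3)[of j y] v(3)[of y] by simp
      assume "x \<notin> Fw w ` SG"
      then show "plant i v x = 0"
        using y p(3)[of j y] v(4)[of y] w(3) by auto
    next
      show "\<exists>z\<in>Fw w ` SG. plant i v z > 0"
        using v(5,6) w p(3)[of i z] \<open>z \<in> SG\<close> by (intro bexI[of _ "F i z"]) auto
    qed (use p in auto)
  qed
  then obtain v z where "v \<in> dom_energy" "\<And>x. x \<in> V0 \<Longrightarrow> v x = 0"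
      "\<And>x. x \<in> SG \<Longrightarrow> v x \<ge> 0" "\<And>x. x \<in> SG \<Longrightarrow> x \<notin> Fw w ` SG \<Longrightarrow> v x = 0"
      "z \<in> Fw w ` SG" "v z > 0"
    by blast
  then show thesis by (rule that)
qed

section \<open>The self-similar measure\<close>

lemma q_mod_3: "q (i mod 3) = q i"
  by (simp add: q_def)

lemma F_mod_3: "F (i mod 3) = F i"
  by (simp add: F_def[abs_def] q_mod_3)

lemma norm_q_le: "norm (q i) \<le> 1"
  by (auto simp: q_def norm_vec_def L2_set_def sum_2 power2_eq_square)

text \<open>Since \<open>F i x\<close> is the mean of \<open>x\<close> and \<open>q i\<close>, the
  infinite composition of the maps named by the address is this series. All natural numbers are
  allowed as letters, because \<open>q\<close> reads them modulo 3.\<close>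

definition coding :: "nat stream \<Rightarrow> plane" where
  "coding \<omega> = (\<Sum>n. (1/2) ^ Suc n *\<^sub>R q (\<omega> !! n))"

lemma summable_coding: "summable (\<lambda>n. norm ((1/2) ^ Suc n *\<^sub>R q (\<omega> !! n)))"
proof (rule summable_comparison_test)
  show "\<exists>N. \<forall>n\<ge>N. norm (norm ((1/2) ^ Suc n *\<^sub>R q (\<omega> !! n))) \<le> (1/2) ^ Suc n"
    using norm_q_le by (auto intro!: mult_left_le)
  show "summable (\<lambda>n. (1/2::real) ^ Suc n)"
    by (subst summable_Suc_iff) (simp add: summable_geometric)
qed

lemma norm_coding_le: "norm (coding \<omega>) \<le> 1"
proof -
  have "norm (coding \<omega>) \<le> (\<Sum>n. norm ((1/2) ^ Suc n *\<^sub>R q (\<omega> !! n)))"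
    unfolding coding_def by (rule summable_norm[OF summable_coding])
  also have "\<dots> \<le> (\<Sum>n. (1/2) ^ Suc n)"
  proof (rule suminf_le[OF _ summable_coding])
    show "norm ((1/2) ^ Suc n *\<^sub>R q (\<omega> !! n)) \<le> (1/2) ^ Suc n" for n
      using norm_q_le by (auto intro!: mult_left_le)
    show "summable (\<lambda>n. (1/2::real) ^ Suc n)"
      by (subst summable_Suc_iff) (simp add: summable_geometric)
  qed
  also have "\<dots> = 1"
    using power_half_series by (rule sums_unique[symmetric])
  finally show ?thesis .
qed

lemma coding_Stream: "coding (t ## \<omega>) = F t (coding \<omega>)"
proof -
  have s: "summable (\<lambda>n. (1/2) ^ Suc n *\<^sub>R q (\<omega> !! n))" for \<omega>
    by (rule summable_norm_cancel[OF summable_coding])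
  have "coding (t ## \<omega>) = (\<Sum>n. (1/2) ^ Suc (Suc n) *\<^sub>R q (\<omega> !! n)) + (1/2) *\<^sub>R q t"
    using suminf_split_head[OF s[of "t ## \<omega>"]] by (simp add: coding_def)
  also have "(\<Sum>n. (1/2) ^ Suc (Suc n) *\<^sub>R q (\<omega> !! n)) = (1/2) *\<^sub>R coding \<omega>"
    unfolding coding_def using suminf_scaleR_right[OF s[of \<omega>], of "1/2"] by simp
  finally show ?thesis by (simp add: F_alt scaleR_add_right)
qed

lemma infdist_F_SG: "infdist (F i x) SG \<le> infdist x SG / 2"
proof -
  obtain z where z: "z \<in> SG" "infdist x SG = dist x z"
    using infdist_attains_inf[of SG x] compact_imp_closed[OF compact_SG] q_in_SG[of 0] by auto
  have "F i z \<in> SG" using F_in_SG[of "i mod 3" z] z by (simp add: F_mod_3)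
  then have "infdist (F i x) SG \<le> dist (F i x) (F i z)" by (rule infdist_le)
  then show ?thesis using z by (simp add: dist_F)
qed

text \<open>Removing a letter at most doubles the distance to \<open>SG\<close>, and every coded
  point is within 1 of \<open>q 1\<close>, the origin. So the distance is below every power of
  1/2.\<close>

lemma coding_in_SG: "coding \<omega> \<in> SG"
proof -
  have "infdist (coding \<omega>) SG \<le> (1/2) ^ n" for n
  proof (induction n arbitrary: \<omega>)
    case 0
    have "q 1 = 0" by (simp add: q_simps vec_eq_iff forall_2)
    then show ?case
      using infdist_le[OF q_in_SG[of 1], of "coding \<omega>"] norm_coding_le[of \<omega>] by simp
  next
    case (Suc n)
    have "coding \<omega> = F (shd \<omega>) (coding (stl \<omega>))"
      using coding_Stream[of "shd \<omega>" "stl \<omega>"] by simp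
    then show ?case
      using infdist_F_SG[of "shd \<omega>" "coding (stl \<omega>)"] Suc[of "stl \<omega>"] by simp
  qed
  then have "infdist (coding \<omega>) SG \<le> 0"
    by (intro LIMSEQ_le_const[OF LIMSEQ_power_zero[of "1/2::real"]]) auto
  then have "infdist (coding \<omega>) SG = 0"
    using infdist_nonneg[of "coding \<omega>" SG] by linarith
  then show ?thesis
    using in_closed_iff_infdist_zero[OF compact_imp_closed[OF compact_SG]] q_in_SG[of 0] by auto
qed

section \<open>The law of a random address\<close>

definition letters :: "nat measure" where
  "letters = measure_pmf (pmf_of_set {..<3})"

definition coding_measure :: "plane measure" where
  "coding_measure = distr (stream_space letters) borel coding"

lemma measurable_q_letters [measurable]: "q \<in> measurable letters borel"
  unfolding letters_def by simp

lemma measurable_coding [measurable]: "coding \<in> measurable (stream_space letters) borel"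
  unfolding coding_def[abs_def] by measurable

lemma measurable_F [measurable]: "F i \<in> borel_measurable borel"
  by (intro borel_measurable_continuous_onI continuous_F)

lemma prob_space_letters: "prob_space letters"
  unfolding letters_def by (rule prob_space_measure_pmf)

lemma prob_space_coding: "prob_space coding_measure"
  unfolding coding_measure_def
  by (intro prob_space.prob_space_distr prob_space.prob_space_stream_space prob_space_letters) simp

lemma sets_coding [simp, measurable_cong]: "sets coding_measure = sets borel"
  by (simp add: coding_measure_def)

text \<open>Condition on the first letter: it is uniform on three values, and the remaining stream
  is a fresh copy to which \<open>F t\<close> is applied.\<close>

lemma coding_measure_self_similar:
  assumes A [measurable]: "A \<in> sets borel"
  shows "measure coding_measure A = (\<Sum>i<3. measure coding_measure (F i -` A)) / 3"
proof -
  interpret prob_space coding_measure by (rule prob_space_coding)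
  let ?S = "stream_space letters"
  have sp: "space ?S = UNIV" by (simp add: space_stream_space letters_def)
  have F [measurable]: "F i -` A \<in> sets borel" for i
    using measurable_sets[OF measurable_F A] by simp
  have em: "emeasure coding_measure B = emeasure ?S (coding -` B)" if "B \<in> sets borel" for B
    using that by (simp add: coding_measure_def emeasure_distr sp)
  have [measurable]: "coding -` A \<in> sets ?S"
    using measurable_sets[OF measurable_coding A] by (simp add: sp)
  have "emeasure coding_measure A = (\<integral>\<^sup>+t. emeasure ?S {\<omega>\<in>space ?S. t ## \<omega> \<in> coding -` A} \<partial>letters)"
    unfolding em[OF A] by (rule prob_space.emeasure_stream_space[OF prob_space_letters]) measurable
  also have "\<dots> = (\<integral>\<^sup>+t. emeasure coding_measure (F t -` A) \<partial>letters)"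
    by (intro nn_integral_cong) (simp add: em sp coding_Stream vimage_def)
  also have "\<dots> = (\<Sum>i<3. emeasure coding_measure (F i -` A)) / 3"
    unfolding letters_def by (subst nn_integral_pmf_of_set) (auto simp: lessThan_empty_iff)
  also have "\<dots> = ennreal ((\<Sum>i<3. measure coding_measure (F i -` A)) / 3)"
    by (simp add: emeasure_eq_measure sum_nonneg divide_ennreal[symmetric] ennreal_numeral)
  finally show ?thesis
    by (simp add: emeasure_eq_measure sum_nonneg)
qed

lemma SG_borel [measurable]: "SG \<in> sets borel"
  using compact_SG by (rule borel_compact)

lemma cell_borel [measurable]: "Fw w ` SG \<in> sets borel"
  using compact_cell by (rule borel_compact)

lemma coding_measure_SG: "measure coding_measure SG = 1"
proof -
  have "measure coding_measure SG = measure (stream_space letters) (coding -` SG \<inter> space (stream_space letters))"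
    unfolding coding_measure_def by (rule measure_distr) auto
  also have "coding -` SG \<inter> space (stream_space letters) = space (stream_space letters)"
    using coding_in_SG by auto
  finally show ?thesis
    using prob_space.prob_space[OF prob_space.prob_space_stream_space[OF prob_space_letters]] by simp
qed

lemma coding_measure_null:
  assumes "B \<in> sets borel" "B \<inter> SG = {}"
  shows "measure coding_measure B = 0"
proof -
  interpret prob_space coding_measure by (rule prob_space_coding)
  have "measure coding_measure (B \<union> SG) = measure coding_measure B + measure coding_measure SG"
    using assms by (intro finite_measure_Union) auto
  then show ?thesis
    using coding_measure_SG prob_le_1[of "B \<union> SG"] measure_nonneg[of coding_measure B] by linarith
qed

text \<open>Among the preimages of \<open>{q j}\<close> only the one under \<open>F j\<close> meets
  \<open>SG\<close>, and it is \<open>{q j}\<close> itself. Hence the mass is a third of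
  itself.\<close>

lemma coding_measure_q:
  assumes "j < 3"
  shows "measure coding_measure {q j} = 0"
proof -
  interpret prob_space coding_measure by (rule prob_space_coding)
  have other: "measure coding_measure (F i -` {q j}) = 0" if "i < 3" "i \<noteq> j" for i
  proof (rule coding_measure_null)
    show "F i -` {q j} \<in> sets borel" using measurable_sets[OF measurable_F, of "{q j}" i] by simp
    have "x \<notin> SG" if "F i x = q j" for x
      using cells_meet[of i j x "q j"] cells_meet[of j i "q j" x] that \<open>i < 3\<close> \<open>i \<noteq> j\<close> assms q_in_SG[of j]
        bary_q[of i j] bary_q[of j j] by auto
    then show "F i -` {q j} \<inter> SG = {}" by auto
  qed
  have self: "F j -` {q j} = {q j}"
    using F_eq_iff[of j _ "q j"] by (auto simp del: F_eq_iff)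
  have "measure coding_measure {q j} = (\<Sum>i<3. measure coding_measure (F i -` {q j})) / 3"
    by (rule coding_measure_self_similar) simp
  also have "(\<Sum>i<3. measure coding_measure (F i -` {q j})) = (\<Sum>i<3. if i = j then measure coding_measure {q j} else 0)"
    using other self by (intro sum.cong) auto
  finally show ?thesis using assms by simp
qed

text \<open>The preimage under the first map of the word is the cell of the shorter word. The other
  two preimages meet \<open>SG\<close> in at most the corner \<open>q j\<close>, a null set, so
  overlaps of cells do not disturb the count.\<close>

lemma coding_measure_cell:
  "w \<in> words r \<Longrightarrow> measure coding_measure (Fw w ` SG) = 1 / 3 ^ r"
proof (induction r arbitrary: w)
  case 0
  then show ?case using coding_measure_SG by simp
next
  case (Suc r)
  interpret prob_space coding_measure by (rule prob_space_coding)
  obtain j w' where w: "j < 3" "w' \<in> words r" "w = j # w'" using Suc.prems by (auto simp: words_Suc)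
  note sub = words_subset[OF w(2)]
  have other: "measure coding_measure (F i -` (Fw w ` SG)) = 0" if "i < 3" "i \<noteq> j" for i
  proof -
    have m: "F i -` (Fw w ` SG) \<in> sets borel" using measurable_sets[OF measurable_F, of "Fw w ` SG" i] by simp
    have "x = q j" if x: "F i x \<in> Fw w ` SG" "x \<in> SG" for x
    proof -
      obtain y where "y \<in> SG" "F i x = F j y" using x w sub by auto
      then show ?thesis using cells_meet[of i j x y] that w \<open>i < 3\<close> \<open>i \<noteq> j\<close> by auto
    qed
    then have "F i -` (Fw w ` SG) - {q j} \<subseteq> - SG" by auto
    then have "measure coding_measure (F i -` (Fw w ` SG) - {q j}) = 0"
      using m by (intro coding_measure_null) auto
    moreover have "measure coding_measure (F i -` (Fw w ` SG)) \<le>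
        measure coding_measure (F i -` (Fw w ` SG) - {q j} \<union> {q j})"
      using m by (intro finite_measure_mono) auto
    moreover have "\<dots> \<le> measure coding_measure (F i -` (Fw w ` SG) - {q j}) + measure coding_measure {q j}"
      using m by (intro measure_Un_le) auto
    ultimately show ?thesis
      using coding_measure_q[OF w(1)] measure_nonneg[of coding_measure "F i -` (Fw w ` SG)"] by linarith
  qed
  have self: "F j -` (Fw w ` SG) = Fw w' ` SG"
    using w by (auto simp: image_iff)
  have "measure coding_measure (Fw w ` SG) = (\<Sum>i<3. measure coding_measure (F i -` (Fw w ` SG))) / 3"
    by (rule coding_measure_self_similar) simp
  also have "(\<Sum>i<3. measure coding_measure (F i -` (Fw w ` SG))) = (\<Sum>i<3. if i = j then 1 / 3 ^ r else 0)"
    using other self Suc.IH[OF w(2)] by (intro sum.cong) auto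
  finally show ?case using w by simp
qed

lemma is_SG_measure_coding: "is_SG_measure coding_measure"
  unfolding is_SG_measure_def
  using prob_space_coding coding_measure_self_similar coding_measure_cell by auto

lemma card_words: "card (words r) = 3 ^ r"
  unfolding words_def using card_lists_length_eq[of "{..<3::nat}" r] by (simp add: conj_commute)

text \<open>Uniqueness uses only the values on cells: since they add up to 1, cells overlap in null
  sets, so the measure of every union of cells is determined.\<close>

definition cell_measure :: "plane measure \<Rightarrow> bool" where
  "cell_measure M \<longleftrightarrow> prob_space M \<and> sets M = sets borel \<and>
     (\<forall>r. \<forall>w\<in>words r. measure M (Fw w ` SG) = 1 / 3 ^ r)"

lemma measure_cells_Union:
  assumes "cell_measure M" "W \<subseteq> words r"
  shows "measure M (\<Union>w\<in>W. Fw w ` SG) = card W / 3 ^ r"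
proof -
  interpret prob_space M using assms by (simp add: cell_measure_def)
  have [measurable_cong, simp]: "sets M = sets borel" using assms by (simp add: cell_measure_def)
  \<comment> \<open>Subadditivity gives an upper bound for any set of words. Applied to the
    complement of \<open>W\<close>, it turns into the lower bound because the total mass is
    1.\<close>
  have le: "measure M (\<Union>w\<in>X. Fw w ` SG) \<le> card X / 3 ^ r" if "X \<subseteq> words r" for X
  proof -
    have "measure M (\<Union>w\<in>X. Fw w ` SG) \<le> (\<Sum>w\<in>X. measure M (Fw w ` SG))"
      using that finite_words[of r] by (intro measure_UNION_le) (auto intro: finite_subset)
    also have "\<dots> = (\<Sum>w\<in>X. 1 / 3 ^ r)"
      using assms(1) that by (intro sum.cong) (auto simp: cell_measure_def)
    finally show ?thesis by simp
  qed
  have fin: "finite W" using assms(2) finite_words finite_subset by blast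
  have "measure M SG = 1"
    using assms(1) by (auto simp: cell_measure_def dest: spec[of _ 0])
  moreover have "(\<Union>w\<in>words r. Fw w ` SG) =
      (\<Union>w\<in>W. Fw w ` SG) \<union> (\<Union>w\<in>words r - W. Fw w ` SG)"
    using assms(2) by blast
  then have "SG = (\<Union>w\<in>W. Fw w ` SG) \<union> (\<Union>w\<in>words r - W. Fw w ` SG)"
    by (rule trans[OF SG_cells])
  moreover have "measure M ((\<Union>w\<in>W. Fw w ` SG) \<union> (\<Union>w\<in>words r - W. Fw w ` SG)) \<le>
      measure M (\<Union>w\<in>W. Fw w ` SG) + measure M (\<Union>w\<in>words r - W. Fw w ` SG)"
    using fin finite_words[of r] by (intro measure_Un_le) (auto intro!: sets.finite_UN)
  moreover have "measure M (\<Union>w\<in>words r - W. Fw w ` SG) \<le> card (words r - W) / 3 ^ r"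
    by (rule le) auto
  moreover have "real (card (words r - W)) / 3 ^ r = 1 - card W / 3 ^ r"
    using assms(2) card_mono[OF finite_words assms(2)]
    by (simp add: card_Diff_subset[OF fin] card_words of_nat_diff diff_divide_distrib)
  ultimately have "measure M (\<Union>w\<in>W. Fw w ` SG) \<ge> card W / 3 ^ r" by simp
  with le[OF assms(2)] show ?thesis by simp
qed

text \<open>The union of the r-cells meeting \<open>C\<close> covers \<open>C\<close> up to a null
  set, has the same mass under both measures, and lies in the \<open>B / 2 ^ r\<close>-neighbourhood
  of \<open>C\<close>. These neighbourhoods decrease to a subset of the closed set
  \<open>C\<close>.\<close>

lemma cell_measure_closed_le:
  assumes M: "cell_measure M" and N: "cell_measure N" and C: "closed C"
  shows "measure M C \<le> measure N C"
proof (cases "C = {}")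
  case False
  interpret M: prob_space M using M by (simp add: cell_measure_def)
  interpret N: prob_space N using N by (simp add: cell_measure_def)
  have sM [measurable_cong, simp]: "sets M = sets borel" using M by (simp add: cell_measure_def)
  have sN [measurable_cong, simp]: "sets N = sets borel" using N by (simp add: cell_measure_def)
  obtain B where B: "\<And>y z. y \<in> SG \<Longrightarrow> z \<in> SG \<Longrightarrow> dist y z \<le> B"
    using compact_imp_bounded[OF compact_SG] by (meson bounded_two_points)
  have "B \<ge> 0" using B[OF q_in_SG[of 0] q_in_SG[of 0]] by simp
  define D where "D r = {x\<in>SG. infdist x C \<le> B / 2 ^ r}" for r :: nat
  have D [measurable]: "D r \<in> sets borel" for r
  proof -
    have "closed {x. infdist x C \<le> B / 2 ^ r}"
      by (intro closed_Collect_le continuous_intros)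
    then have "closed (SG \<inter> {x. infdist x C \<le> B / 2 ^ r})"
      using compact_imp_closed[OF compact_SG] by (rule closed_Int[rotated])
    then show ?thesis by (simp add: D_def Collect_conj_eq)
  qed
  have "measure M C \<le> measure N (D r)" for r
  proof -
    define W where "W = {w\<in>words r. Fw w ` SG \<inter> C \<noteq> {}}"
    have W: "W \<subseteq> words r" by (auto simp: W_def)
    have fin: "finite W" using W finite_words finite_subset by blast
    have U [measurable]: "(\<Union>w\<in>W. Fw w ` SG) \<in> sets borel"
      using fin by (intro sets.finite_UN) auto
    have "measure M C = measure M (C \<inter> SG)"
    proof -
      have "measure M SG = 1" using M by (auto simp: cell_measure_def dest: spec[of _ 0])
      then have "AE x in M. x \<in> SG" by (subst M.prob_eq_1[symmetric]) auto
      then show ?thesis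
        using C by (intro measure_eq_AE) (auto elim!: eventually_mono)
    qed
    also have "\<dots> \<le> measure M (\<Union>w\<in>W. Fw w ` SG)"
    proof (rule M.finite_measure_mono)
      show "C \<inter> SG \<subseteq> (\<Union>w\<in>W. Fw w ` SG)"
      proof
        fix x assume x: "x \<in> C \<inter> SG"
        then obtain w where "w \<in> words r" "x \<in> Fw w ` SG"
          using SG_cells[of r] by blast
        then show "x \<in> (\<Union>w\<in>W. Fw w ` SG)" using x unfolding W_def by blast
      qed
    qed simp
    also have "\<dots> = measure N (\<Union>w\<in>W. Fw w ` SG)"
      using measure_cells_Union[OF M W] measure_cells_Union[OF N W] by simp
    also have "\<dots> \<le> measure N (D r)"
    proof (rule N.finite_measure_mono)
      show "(\<Union>w\<in>W. Fw w ` SG) \<subseteq> D r"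
      proof safe
        fix w x assume w: "w \<in> W" and x: "x \<in> SG"
        obtain y where y: "y \<in> SG" "Fw w y \<in> C" using w by (auto simp: W_def)
        have "infdist (Fw w x) C \<le> dist (Fw w x) (Fw w y)" using y by (intro infdist_le)
        also have "\<dots> \<le> B / 2 ^ r"
          using B[OF x y(1)] w by (simp add: dist_Fw W_def words_def divide_right_mono)
        finally show "Fw w x \<in> D r"
          using words_subset[of w r] w x by (auto simp: D_def W_def)
      qed
    qed simp
    finally show ?thesis .
  qed
  moreover have "(\<lambda>r. measure N (D r)) \<longlonglongrightarrow> measure N (\<Inter>r. D r)"
  proof (rule N.finite_Lim_measure_decseq)
    show "decseq D"
      unfolding decseq_def D_def using \<open>B \<ge> 0\<close>
      by (auto elim!: order_trans intro!: divide_left_mono power_increasing)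
  qed auto
  ultimately have "measure M C \<le> measure N (\<Inter>r. D r)"
    by (intro LIMSEQ_le_const) auto
  also have "\<dots> \<le> measure N C"
  proof (rule N.finite_measure_mono)
    show "(\<Inter>r. D r) \<subseteq> C"
    proof
      fix x assume "x \<in> (\<Inter>r. D r)"
      then have "infdist x C \<le> B / 2 ^ r" for r by (auto simp: D_def)
      moreover have "(\<lambda>r. B / 2 ^ r) \<longlonglongrightarrow> 0"
        by (rule LIMSEQ_divide_realpow_zero) simp
      ultimately have "infdist x C \<le> 0" by (intro LIMSEQ_le_const) auto
      then have "infdist x C = 0" using infdist_nonneg[of x C] by linarith
      then show "x \<in> C" using in_closed_iff_infdist_zero[OF C False] by simp
    qed
  qed (use C in simp)
  finally show ?thesis .
qed simp

lemma cell_measure_unique: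
  assumes M: "cell_measure M" and N: "cell_measure N"
  shows "M = N"
proof (rule measure_eqI_generator_eq[where E = "Collect closed" and \<Omega> = UNIV and A = "\<lambda>_. UNIV"])
  interpret M: prob_space M using M by (simp add: cell_measure_def)
  interpret N: prob_space N using N by (simp add: cell_measure_def)
  have "sets borel = sigma_sets UNIV (Collect closed :: plane set set)"
    by (simp add: borel_eq_closed)
  then show "sets M = sigma_sets UNIV (Collect closed)" "sets N = sigma_sets UNIV (Collect closed)"
    using M N by (simp_all add: cell_measure_def)
  show "emeasure M X = emeasure N X" if "X \<in> Collect closed" for X
    using cell_measure_closed_le[OF M N, of X] cell_measure_closed_le[OF N M, of X] that
    by (simp add: M.emeasure_eq_measure N.emeasure_eq_measure)
  show "emeasure M UNIV \<noteq> \<infinity>" by simp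
qed (auto simp: Int_stable_def)

text \<open>\<open>coding_measure\<close> satisfies the full characterization, and any other
  candidate agrees with it through its values on cells.\<close>

lemma cell_measure_\<mu>: "cell_measure \<mu>"
proof -
  have c: "is_SG_measure M \<Longrightarrow> cell_measure M" for M
    by (simp add: is_SG_measure_def cell_measure_def)
  have "is_SG_measure \<mu>"
    unfolding \<mu>_def
    by (rule theI[where P = is_SG_measure, OF is_SG_measure_coding])
      (metis c cell_measure_unique is_SG_measure_coding)
  then show ?thesis by (rule c)
qed

lemma prob_space_\<mu>: "prob_space \<mu>"
  using cell_measure_\<mu> by (simp add: cell_measure_def)

lemma sets_\<mu> [simp, measurable_cong]: "sets \<mu> = sets borel"
  using cell_measure_\<mu> by (simp add: cell_measure_def)

lemma measure_\<mu>_cell: "w \<in> words r \<Longrightarrow> measure \<mu> (Fw w ` SG) = 1 / 3 ^ r"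
  using cell_measure_\<mu> by (simp add: cell_measure_def)

section \<open>The Laplacian and the Green operator\<close>

lemma SG_set_integrable:
  assumes "continuous_on SG (f :: plane \<Rightarrow> real)"
  shows "set_integrable \<mu> SG f"
proof -
  interpret prob_space \<mu> by (rule prob_space_\<mu>)
  have "bounded (f ` SG)"
    by (intro compact_imp_bounded compact_continuous_image assms compact_SG)
  then obtain B where B: "\<And>x. x \<in> SG \<Longrightarrow> \<bar>f x\<bar> \<le> B"
    by (auto simp: bounded_iff)
  have m: "(\<lambda>x. indicator SG x *\<^sub>R f x) \<in> borel_measurable \<mu>"
    using borel_measurable_continuous_on_indicator[OF SG_borel assms]
    by (simp cong: measurable_cong_sets)
  show ?thesis
    unfolding set_integrable_def
    by (rule integrable_const_bound[of _ "\<bar>B\<bar>", OF _ m])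
      (use B in \<open>force intro!: AE_I2 simp: indicator_def\<close>)
qed

lemma L2_inner_commute: "L2_inner f g = L2_inner g f"
  by (simp add: L2_inner_def mult.commute)

lemma L2_inner_cong:
  assumes "\<And>x. x \<in> SG \<Longrightarrow> f x = f' x" "\<And>x. x \<in> SG \<Longrightarrow> g x = g' x"
  shows "L2_inner f g = L2_inner f' g'"
  unfolding L2_inner_def by (rule set_lebesgue_integral_cong) (use assms in auto)

lemma L2_inner_lincomb_left:
  assumes "continuous_on SG f" "continuous_on SG f'" "continuous_on SG g"
  shows "L2_inner (\<lambda>x. a * f x + b * f' x) g = a * L2_inner f g + b * L2_inner f' g"
proof -
  have "L2_inner (\<lambda>x. a * f x + b * f' x) g = (LINT x:SG|\<mu>. a * (f x * g x) + b * (f' x * g x))"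
    by (simp add: L2_inner_def algebra_simps)
  also have "\<dots> = (LINT x:SG|\<mu>. a * (f x * g x)) + (LINT x:SG|\<mu>. b * (f' x * g x))"
    by (intro set_integral_add SG_set_integrable continuous_intros assms)
  finally show ?thesis by (simp add: L2_inner_def)
qed

lemma cell_above:
  assumes "continuous_on SG f" "z \<in> SG" "f z > (c::real)"
  obtains r w where "w \<in> words r" "\<And>x. x \<in> Fw w ` SG \<Longrightarrow> f x > c"
proof -
  have "open {c<..}" by simp
  then obtain U where U: "open U" "U \<inter> SG = f -` {c<..} \<inter> SG"
    using assms(1) unfolding continuous_on_open_invariant by blast
  then have "z \<in> U" using assms by auto
  then obtain r w where w: "w \<in> words r" "Fw w ` SG \<subseteq> U"
    using assms(2) by (rule small_cell[OF U(1)])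
  show thesis
  proof (rule that[OF w(1)])
    show "f x > c" if "x \<in> Fw w ` SG" for x
      using that w(2) U(2) words_subset[OF w(1)] by blast
  qed
qed

text \<open>Continuity keeps \<open>g\<close> above half its value at \<open>z\<close> on a whole
  cell containing \<open>z\<close>, and every cell has positive mass.\<close>

lemma SG_integral_pos:
  assumes g: "continuous_on SG g" "\<And>x. x \<in> SG \<Longrightarrow> g x \<ge> 0" and z: "z \<in> SG" "g z > (0::real)"
  shows "(LINT x:SG|\<mu>. g x) > 0"
proof -
  interpret prob_space \<mu> by (rule prob_space_\<mu>)
  have half: "g z > g z / 2" using z by simp
  obtain r w where w: "w \<in> words r" "\<And>x. x \<in> Fw w ` SG \<Longrightarrow> g x > g z / 2"
    by (rule cell_above[OF g(1) z(1) half], rule that)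
  have sub: "Fw w ` SG \<subseteq> SG" using words_subset[OF w(1)] .
  have "0 < g z / 2 * measure \<mu> (Fw w ` SG)"
    using z measure_\<mu>_cell[OF w(1)] by simp
  also have "\<dots> = (LINT x:SG|\<mu>. g z / 2 * indicator (Fw w ` SG) x)"
    using sub by (simp add: set_lebesgue_integral_def indicator_inter_arith[symmetric] Int_absorb1 mult.commute
      Int_commute flip: scaleR_conv_of_real)
  also have "\<dots> \<le> (LINT x:SG|\<mu>. g x)"
  proof (rule set_integral_mono)
    show "set_integrable \<mu> SG (\<lambda>x. g z / 2 * indicator (Fw w ` SG) x)"
      unfolding set_integrable_def
      by (rule integrable_const_bound[of _ "\<bar>g z\<bar>"]) (auto simp: indicator_def)
    show "set_integrable \<mu> SG g" by (rule SG_set_integrable[OF g(1)])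
    show "g z / 2 * indicator (Fw w ` SG) x \<le> g x" if "x \<in> SG" for x
      using w(2)[of x] g(2)[OF that] by (cases "x \<in> Fw w ` SG") (simp_all add: less_imp_le)
  qed
  finally show ?thesis .
qed

lemma L2_inner_pos:
  assumes "continuous_on SG f" "z \<in> SG" "f z \<noteq> 0"
  shows "L2_inner f f > 0"
  unfolding L2_inner_def
  by (rule SG_integral_pos[of _ z]) (use assms in \<open>auto intro!: continuous_intros simp: zero_less_mult_iff\<close>)

lemma has_laplacian_test:
  "has_laplacian u f \<Longrightarrow> v \<in> dom_energy \<Longrightarrow> (\<And>x. x \<in> V0 \<Longrightarrow> v x = 0) \<Longrightarrow> energy u v = - L2_inner f v"
  by (simp add: has_laplacian_def L2_inner_def)

lemma has_laplacian_dom: "has_laplacian u f \<Longrightarrow> u \<in> dom_energy"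
  by (simp add: has_laplacian_def)

lemma has_laplacian_continuous: "has_laplacian u f \<Longrightarrow> continuous_on SG f"
  by (simp add: has_laplacian_def)

text \<open>If the difference were positive somewhere, it would be positive on a cell; testing it
  against a bump supported there gives a positive integral, while the weak equations make that
  integral 0. The one-sided form suffices, as the roles can be exchanged.\<close>

lemma has_laplacian_unique_le:
  assumes "has_laplacian u f" "has_laplacian u f'" "x \<in> SG"
  shows "f x \<le> f' x"
proof (rule ccontr)
  assume "\<not> f x \<le> f' x"
  define h where "h y = 1 * f y + (-1) * f' y" for y
  have h: "continuous_on SG h" "h x > 0"
    using \<open>\<not> f x \<le> f' x\<close> unfolding h_def
    by (auto intro!: continuous_intros has_laplacian_continuous[OF assms(1)] has_laplacian_continuous[OF assms(2)])
  obtain r w where w: "w \<in> words r" and cell: "\<And>y. y \<in> Fw w ` SG \<Longrightarrow> h y > 0"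
    by (rule cell_above[OF h(1) assms(3) h(2)], rule that)
  obtain v z where v: "v \<in> dom_energy" "\<And>x. x \<in> V0 \<Longrightarrow> v x = 0" "\<And>x. x \<in> SG \<Longrightarrow> v x \<ge> 0"
    "\<And>x. x \<in> SG \<Longrightarrow> x \<notin> Fw w ` SG \<Longrightarrow> v x = 0" "z \<in> Fw w ` SG" "v z > 0"
    by (rule bump_exists[OF w], rule that)
  have "L2_inner h v = 0"
    unfolding h_def
    using L2_inner_lincomb_left[OF has_laplacian_continuous[OF assms(1)] has_laplacian_continuous[OF assms(2)]
        dom_energy_continuous[OF v(1)], of 1 "-1"]
      has_laplacian_test[OF assms(1) v(1,2)] has_laplacian_test[OF assms(2) v(1,2)] by simp
  moreover have "L2_inner h v > 0"
    unfolding L2_inner_def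
  proof (rule SG_integral_pos[of _ z])
    show "continuous_on SG (\<lambda>x. h x * v x)"
      by (intro continuous_intros h dom_energy_continuous v)
    show "z \<in> SG" using v(5) words_subset[OF w] by blast
    show "h z * v z > 0" using v(5,6) cell by simp
    show "h y * v y \<ge> 0" if "y \<in> SG" for y
      using v(3,4)[OF that] cell[of y] by (cases "y \<in> Fw w ` SG") auto
  qed
  ultimately show False by simp
qed

lemma has_laplacian_unique:
  "has_laplacian u f \<Longrightarrow> has_laplacian u f' \<Longrightarrow> x \<in> SG \<Longrightarrow> f x = f' x"
  by (intro antisym has_laplacian_unique_le)

lemma has_laplacian_cong:
  assumes "\<And>x. x \<in> SG \<Longrightarrow> u x = u' x" "\<And>x. x \<in> SG \<Longrightarrow> f x = f' x"
  shows "has_laplacian u f \<longleftrightarrow> has_laplacian u' f'"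
proof -
  have "(LINT x:SG|\<mu>. f x * v x) = (LINT x:SG|\<mu>. f' x * v x)" for v
    by (rule set_lebesgue_integral_cong) (use assms in auto)
  moreover have "energy u v = energy u' v" for v
    by (rule energy_cong) (use assms in auto)
  moreover have "u \<in> dom_energy \<longleftrightarrow> u' \<in> dom_energy"
    by (rule dom_energy_cong) (use assms in auto)
  moreover have "continuous_on SG f \<longleftrightarrow> continuous_on SG f'"
    by (rule continuous_on_cong) (use assms in auto)
  ultimately show ?thesis unfolding has_laplacian_def by simp
qed

lemma has_laplacian_lincomb:
  assumes "has_laplacian u f" "has_laplacian u' f'"
  shows "has_laplacian (\<lambda>x. a * u x + b * u' x) (\<lambda>x. a * f x + b * f' x)"
  unfolding has_laplacian_def
proof (intro conjI ballI impI)
  note d = has_laplacian_dom[OF assms(1)] has_laplacian_dom[OF assms(2)]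
  note c = has_laplacian_continuous[OF assms(1)] has_laplacian_continuous[OF assms(2)]
  show "(\<lambda>x. a * u x + b * u' x) \<in> dom_energy" by (intro dom_energy_lincomb d)
  show "continuous_on SG (\<lambda>x. a * f x + b * f' x)" by (intro continuous_intros c)
  fix v assume v: "v \<in> dom_energy" "\<forall>x\<in>V0. v x = 0"
  show "energy (\<lambda>x. a * u x + b * u' x) v = - (LINT x:SG|\<mu>. (a * f x + b * f' x) * v x)"
    using energy_lincomb_left[OF d v(1), of a b] has_laplacian_test[OF assms(1) v(1)] v
      has_laplacian_test[OF assms(2) v(1)] L2_inner_lincomb_left[OF c dom_energy_continuous[OF v(1)], of a b]
    by (simp add: L2_inner_def)
qed

lemma has_laplacian_laplacian:
  assumes "has_laplacian u f"
  shows "has_laplacian u (laplacian u)"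
proof -
  \<comment> \<open>Cutting \<open>f\<close> off outside \<open>SG\<close> meets the normalization
    in the description, and turns uniqueness on \<open>SG\<close> into equality of
    functions.\<close>
  let ?f = "\<lambda>x. if x \<in> SG then f x else 0"
  have *: "has_laplacian u ?f \<and> (\<forall>x. x \<notin> SG \<longrightarrow> ?f x = 0)"
    using has_laplacian_cong[of u u ?f f] assms by simp
  have "has_laplacian u (laplacian u) \<and> (\<forall>x. x \<notin> SG \<longrightarrow> laplacian u x = 0)"
    unfolding laplacian_def
  proof (rule theI[of _ ?f])
    fix g assume g: "has_laplacian u g \<and> (\<forall>x. x \<notin> SG \<longrightarrow> g x = 0)"
    show "g = ?f"
    proof
      show "g x = ?f x" for x
        using g * has_laplacian_unique[of u g ?f x] by (cases "x \<in> SG") auto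
    qed
  qed (fact *)
  then show ?thesis ..
qed

lemma laplacian_eq: "has_laplacian u f \<Longrightarrow> x \<in> SG \<Longrightarrow> laplacian u x = f x"
  using has_laplacian_unique has_laplacian_laplacian by blast

lemma laplacian_cong:
  assumes "\<And>x. x \<in> SG \<Longrightarrow> u x = u' x"
  shows "laplacian u = laplacian u'"
proof -
  have "has_laplacian u f \<longleftrightarrow> has_laplacian u' f" for f
    by (rule has_laplacian_cong) (use assms in auto)
  then show ?thesis by (simp add: laplacian_def)
qed

lemma laplacian_pow_cong:
  assumes "\<And>x. x \<in> SG \<Longrightarrow> u x = u' x" "x \<in> SG"
  shows "(laplacian ^^ n) u x = (laplacian ^^ n) u' x"
proof (cases n)
  case (Suc k)
  then show ?thesis using laplacian_cong[of u u'] assms by (simp add: funpow_Suc_right del: funpow.simps)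
qed (use assms in simp)

text \<open>The difference vanishes on \<open>V0\<close>, so it is an admissible test function for
  itself and has zero energy.\<close>

lemma zero_boundary_unique:
  assumes "has_laplacian u f" "has_laplacian u' f" "\<And>x. x \<in> V0 \<Longrightarrow> u x = u' x" "x \<in> SG"
  shows "u x = u' x"
proof -
  let ?d = "\<lambda>x. 1 * u x + (-1) * u' x"
  have h: "has_laplacian ?d (\<lambda>x. 1 * f x + (-1) * f x)"
    by (intro has_laplacian_lincomb assms)
  have z: "?d x = 0" if "x \<in> V0" for x using assms(3)[OF that] by simp
  have "energy ?d ?d = - L2_inner (\<lambda>x. 1 * f x + (-1) * f x) ?d"
    by (rule has_laplacian_test[OF h has_laplacian_dom[OF h] z])
  then have "energy ?d ?d = 0" by (simp add: L2_inner_def)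
  from energy_zero_eq_zero[OF has_laplacian_dom[OF h] this z assms(4)]
  show ?thesis by simp
qed

text \<open>Existence is supplied by the given \<open>u\<close>, uniqueness by
  \<open>zero_boundary_unique\<close>; the description is thus justified for exactly those
  \<open>f\<close> for which a solution has been exhibited.\<close>

lemma green_eq:
  assumes "has_laplacian u f" "\<And>x. x \<in> V0 \<Longrightarrow> u x = 0" "x \<in> SG"
  shows "green f x = u x"
proof -
  let ?u = "\<lambda>x. if x \<in> SG then u x else 0"
  have V0: "x \<in> V0 \<Longrightarrow> x \<in> SG" for x using V_subset_SG[of 0] by auto
  have *: "has_laplacian ?u f \<and> (\<forall>x\<in>V0. ?u x = 0) \<and> (\<forall>x. x \<notin> SG \<longrightarrow> ?u x = 0)"
    using has_laplacian_cong[of ?u u f f] assms by auto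
  have "green f = ?u"
    unfolding green_def
  proof (rule the_equality[where a = ?u])
    show "has_laplacian ?u f \<and> (\<forall>x\<in>V0. ?u x = 0) \<and> (\<forall>x. x \<notin> SG \<longrightarrow> ?u x = 0)"
      by (fact *)
  next
    fix g assume g: "has_laplacian g f \<and> (\<forall>x\<in>V0. g x = 0) \<and> (\<forall>x. x \<notin> SG \<longrightarrow> g x = 0)"
    show "g = ?u"
    proof
      show "g x = ?u x" for x
        using zero_boundary_unique[of g f ?u x] g * by (cases "x \<in> SG") auto
    qed
  qed
  then show ?thesis using assms by simp
qed

lemma green_cong:
  assumes "\<And>x. x \<in> SG \<Longrightarrow> f x = f' x"
  shows "green f = green f'"
proof -
  have "has_laplacian u f \<longleftrightarrow> has_laplacian u f'" for u
    by (rule has_laplacian_cong) (use assms in auto)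
  then show ?thesis by (simp add: green_def)
qed

text \<open>Both functions vanish on \<open>V0\<close>, so each may serve as test function for the
  other, and the energy is symmetric.\<close>

lemma L2_inner_laplacian_symmetric:
  assumes "has_laplacian u f" "\<And>x. x \<in> V0 \<Longrightarrow> u x = 0"
    and "has_laplacian v g" "\<And>x. x \<in> V0 \<Longrightarrow> v x = 0"
  shows "L2_inner u g = L2_inner f v"
  using has_laplacian_test[OF assms(1) has_laplacian_dom[OF assms(3)] assms(4)]
    has_laplacian_test[OF assms(3) has_laplacian_dom[OF assms(1)] assms(2)]
  by (simp add: energy_sym[of u v] L2_inner_commute[of u g])

lemma has_laplacian_hfun: "has_laplacian (hfun a) (\<lambda>x. 0)"
  using energy_hfun_test by (auto simp: has_laplacian_def hfun_dom_energy set_lebesgue_integral_def)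

lemma harmonic_eq_hfun:
  assumes "has_laplacian u (\<lambda>x. 0)" "x \<in> SG"
  shows "u x = hfun (\<lambda>i. u (q i)) x"
  by (rule zero_boundary_unique[OF assms(1) has_laplacian_hfun _ assms(2)])
    (auto simp: V0_def hfun_q simp del: One_nat_def)

lemma q_iterate_in_SG: "i < 3 \<Longrightarrow> (F 0 ^^ r) (q i) \<in> SG"
  by (intro iterate_F_in_SG q_in_SG) auto

lemma has_normal_deriv_cong:
  assumes "\<And>x. x \<in> SG \<Longrightarrow> u x = u' x"
  shows "has_normal_deriv u D 0 \<longleftrightarrow> has_normal_deriv u' D 0"
  using assms by (simp add: has_normal_deriv_0_iff q_iterate_in_SG q_in_SG del: One_nat_def)

lemma has_tangential_deriv_cong:
  assumes "\<And>x. x \<in> SG \<Longrightarrow> u x = u' x"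
  shows "has_tangential_deriv u D 0 \<longleftrightarrow> has_tangential_deriv u' D 0"
  using assms by (simp add: has_tangential_deriv_0_iff q_iterate_in_SG q_in_SG del: One_nat_def)

text \<open>For a harmonic function the three data at \<open>q 0\<close> are the linear forms
  \<open>a 0\<close>, \<open>2 * a 0 - a 1 - a 2\<close> and \<open>a 1 - a 2\<close> in the
  boundary values, and these are independent.\<close>

lemma harmonic_zero_data:
  assumes "has_laplacian u (\<lambda>x. 0)" "u (q 0) = 0" "has_normal_deriv u 0 0" "has_tangential_deriv u 0 0"
    and "x \<in> SG"
  shows "u x = 0"
proof -
  let ?a = "\<lambda>i. u (q i)"
  note eq = harmonic_eq_hfun[OF assms(1)]
  have "has_normal_deriv u (2 * ?a 0 - ?a 1 - ?a 2) 0"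
    using hfun_normal_deriv[of ?a] has_normal_deriv_cong[of u "hfun ?a"] eq by simp
  with assms(3) have 1: "2 * ?a 0 - ?a 1 - ?a 2 = 0"
    unfolding has_normal_deriv_def by (rule LIMSEQ_unique[symmetric])
  have "has_tangential_deriv u (?a 1 - ?a 2) 0"
    using hfun_tangential_deriv[of ?a] has_tangential_deriv_cong[of u "hfun ?a"] eq by simp
  with assms(4) have 2: "?a 1 - ?a 2 = 0"
    unfolding has_tangential_deriv_def by (rule LIMSEQ_unique[symmetric])
  have "u x = 0" if "x \<in> V0" for x
  proof -
    from that obtain i where "i < 3" "x = q i" by (auto simp: V0_def)
    then show ?thesis using 1 2 assms(2) unfolding less_3_iff by auto
  qed
  moreover have "has_laplacian (\<lambda>x. 0 * u x + 0 * u x) (\<lambda>x. 0 * 0 + 0 * 0)"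
    by (intro has_laplacian_lincomb assms(1))
  ultimately show ?thesis
    using zero_boundary_unique[of u "\<lambda>x. 0" "\<lambda>x. 0" x] assms by simp
qed

lemma has_normal_deriv_lincomb:
  assumes "has_normal_deriv u D i" "has_normal_deriv v E i"
  shows "has_normal_deriv (\<lambda>x. a * u x + b * v x) (a * D + b * E) i"
  using tendsto_add[OF tendsto_mult_left[OF assms(1)[unfolded has_normal_deriv_def], of a]
      tendsto_mult_left[OF assms(2)[unfolded has_normal_deriv_def], of b]]
  by (simp add: has_normal_deriv_def algebra_simps)

lemma has_tangential_deriv_lincomb:
  assumes "has_tangential_deriv u D i" "has_tangential_deriv v E i"
  shows "has_tangential_deriv (\<lambda>x. a * u x + b * v x) (a * D + b * E) i"
  using tendsto_add[OF tendsto_mult_left[OF assms(1)[unfolded has_tangential_deriv_def], of a]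
      tendsto_mult_left[OF assms(2)[unfolded has_tangential_deriv_def], of b]]
  by (simp add: has_tangential_deriv_def algebra_simps)

lemma cauchy_data_unique:
  assumes u: "has_laplacian u f" "has_normal_deriv u D 0" "has_tangential_deriv u E 0"
    and v: "has_laplacian v g" "has_normal_deriv v D 0" "has_tangential_deriv v E 0"
    and "\<And>x. x \<in> SG \<Longrightarrow> f x = g x" "u (q 0) = v (q 0)" "x \<in> SG"
  shows "u x = v x"
proof -
  let ?d = "\<lambda>x. 1 * u x + (-1) * v x"
  have "has_laplacian ?d (\<lambda>x. 1 * f x + (-1) * g x)"
    by (intro has_laplacian_lincomb u v)
  then have "has_laplacian ?d (\<lambda>x. 0)"
    by (subst has_laplacian_cong[of ?d ?d _ "\<lambda>x. 1 * f x + (-1) * g x"]) (use assms(7) in auto)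
  moreover have "has_normal_deriv ?d (1 * D + (-1) * D) 0"
    by (intro has_normal_deriv_lincomb u v)
  moreover have "has_tangential_deriv ?d (1 * E + (-1) * E) 0"
    by (intro has_tangential_deriv_lincomb u v)
  ultimately have "?d x = 0"
    using assms(8,9) harmonic_zero_data[of ?d x] by simp
  then show ?thesis by simp
qed

section \<open>Reflection\<close>

text \<open>The mirror image in the vertical axis of the triangle: it fixes \<open>q 0\<close> and
  exchanges \<open>q 1\<close> and \<open>q 2\<close>.\<close>

definition reflect :: "plane \<Rightarrow> plane" where
  "reflect x = vector [1 - x $ 1, x $ 2]"

definition swap12 :: "nat \<Rightarrow> nat" where
  "swap12 i = (if i = 1 then 2 else if i = 2 then 1 else i)"

lemma swap12_less [simp]: "swap12 i < 3 \<longleftrightarrow> i < 3"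
  by (auto simp: swap12_def)

lemma reflect_reflect [simp]: "reflect (reflect x) = x"
  by (simp add: reflect_def vec_eq_iff forall_2)

lemma bary_reflect: "i < 3 \<Longrightarrow> bary i (reflect x) = bary (swap12 i) x"
  by (auto simp: less_3_iff bary_def reflect_def swap12_def)

lemma reflect_F: "i < 3 \<Longrightarrow> reflect (F i x) = F (swap12 i) (reflect x)"
  by (rule bary_eqI) (auto simp: bary_reflect bary_F less_3_iff swap12_def)

lemma reflect_q: "i < 3 \<Longrightarrow> reflect (q i) = q (swap12 i)"
  by (rule bary_eqI) (auto simp: bary_reflect bary_q less_3_iff swap12_def)

lemma continuous_reflect [continuous_intros]: "continuous_on A reflect"
proof -
  have "reflect = (\<lambda>x. \<chi> i. if i = 1 then 1 - x $ 1 else x $ 2)"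
    by (auto simp: fun_eq_iff reflect_def vec_eq_iff forall_2)
  moreover have "continuous_on A (\<lambda>x :: plane. \<chi> i. if i = (1::2) then 1 - x $ 1 else x $ 2)"
  proof (intro continuous_on_vec_lambda)
    show "continuous_on A (\<lambda>x :: plane. if i = (1::2) then 1 - x $ 1 else x $ 2)" for i
      by (cases "i = 1") (auto intro!: continuous_intros)
  qed
  ultimately show ?thesis by metis
qed

lemma reflect_V: "x \<in> V r \<Longrightarrow> reflect x \<in> V r"
proof (induction r arbitrary: x)
  case 0
  then show ?case by (auto simp: V0_def reflect_q)
next
  case (Suc r)
  then obtain i y where "i < 3" "y \<in> V r" "x = F i y" by (auto simp: V_Suc)
  then show ?case using Suc.IH[of y] by (auto simp: V_Suc reflect_F intro!: bexI[of _ "swap12 i"])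
qed

lemma reflect_SG: "x \<in> SG \<Longrightarrow> reflect x \<in> SG"
proof -
  have "reflect ` closure Vstar \<subseteq> closure Vstar"
  proof (rule image_closure_subset)
    show "reflect ` Vstar \<subseteq> closure Vstar"
      using reflect_V closure_subset[of Vstar] unfolding Vstar_def by blast
  qed (auto intro: continuous_intros)
  then show "x \<in> SG \<Longrightarrow> reflect x \<in> SG" by (auto simp: SG_eq_closure)
qed

lemma graph_energy_reflect:
  "graph_energy r (\<lambda>x. u (reflect x)) (\<lambda>x. v (reflect x)) = graph_energy r u v"
proof (induction r arbitrary: u v)
  case 0
  show ?case
    by (simp add: bdry_energy_def reflect_q swap12_def algebra_simps del: One_nat_def)
next
  case (Suc r)
  have "graph_energy (Suc r) (\<lambda>x. u (reflect x)) (\<lambda>x. v (reflect x)) =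
      5/3 * (\<Sum>i<3. graph_energy r (\<lambda>x. (u \<circ> F (swap12 i)) (reflect x)) (\<lambda>x. (v \<circ> F (swap12 i)) (reflect x)))"
    by (simp add: o_def reflect_F)
  also have "\<dots> = 5/3 * (\<Sum>i<3. graph_energy r (u \<circ> F (swap12 i)) (v \<circ> F (swap12 i)))"
    by (simp only: Suc.IH)
  also have "\<dots> = graph_energy (Suc r) u v"
    by (simp add: lessThan_3 swap12_def)
  finally show ?case .
qed

lemma dom_energy_reflect: "u \<in> dom_energy \<Longrightarrow> (\<lambda>x. u (reflect x)) \<in> dom_energy"
  unfolding dom_energy_def
  by (auto simp: graph_energy_reflect[of _ u u] intro!: continuous_on_compose2[of SG u SG reflect] continuous_intros reflect_SG)

lemma energy_reflect: "energy (\<lambda>x. u (reflect x)) (\<lambda>x. v (reflect x)) = energy u v"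
  by (simp add: energy_def graph_energy_reflect)

lemma reflect_Fw: "w \<in> words r \<Longrightarrow> reflect (Fw w x) = Fw (map swap12 w) (reflect x)"
  by (induction r arbitrary: w) (auto simp: words_Suc reflect_F)

lemma measurable_reflect [measurable]: "reflect \<in> borel_measurable borel"
  by (intro borel_measurable_continuous_onI continuous_reflect)

text \<open>The reflection permutes the r-cells, so the image measure has the same values on cells
  and uniqueness applies.\<close>

lemma distr_reflect: "distr \<mu> borel reflect = \<mu>"
proof (rule cell_measure_unique[OF _ cell_measure_\<mu>])
  have [measurable]: "reflect \<in> measurable \<mu> borel"
    using measurable_reflect by (simp cong: measurable_cong_sets)
  show "cell_measure (distr \<mu> borel reflect)"
    unfolding cell_measure_def
  proof (intro conjI allI ballI)
    show "prob_space (distr \<mu> borel reflect)"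
      by (intro prob_space.prob_space_distr prob_space_\<mu>) simp
    fix r w assume w: "w \<in> words r"
    then have w': "map swap12 w \<in> words r" by (auto simp: words_def)
    have "map swap12 (map swap12 w) = w"
      using w by (auto simp: words_def swap12_def intro!: map_idI)
    then have "reflect -` (Fw w ` SG) = Fw (map swap12 w) ` SG"
      using reflect_Fw[OF w] reflect_Fw[OF w'] reflect_SG
      by (auto simp: image_iff) (metis reflect_reflect)+
    then show "measure (distr \<mu> borel reflect) (Fw w ` SG) = 1 / 3 ^ r"
      using measure_\<mu>_cell[OF w'] sets_eq_imp_space_eq[OF sets_\<mu>]
      by (subst measure_distr) auto
  qed simp
qed

lemma SG_integral_reflect:
  assumes "continuous_on SG (g :: plane \<Rightarrow> real)"
  shows "(LINT x:SG|\<mu>. g (reflect x)) = (LINT x:SG|\<mu>. g x)"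
proof -
  have m: "(\<lambda>x. indicator SG x *\<^sub>R g x) \<in> borel_measurable borel"
    using borel_measurable_continuous_on_indicator[OF SG_borel assms] .
  have [measurable]: "reflect \<in> measurable \<mu> borel"
    using measurable_reflect by (simp cong: measurable_cong_sets)
  have "(LINT x:SG|\<mu>. g x) = (LINT x|distr \<mu> borel reflect. indicator SG x *\<^sub>R g x)"
    by (simp add: distr_reflect set_lebesgue_integral_def)
  also have "\<dots> = (LINT x|\<mu>. indicator SG (reflect x) *\<^sub>R g (reflect x))"
    by (rule integral_distr) (use m in simp_all)
  also have "\<dots> = (LINT x:SG|\<mu>. g (reflect x))"
  proof -
    have "reflect x \<in> SG \<longleftrightarrow> x \<in> SG" for x using reflect_SG[of x] reflect_SG[of "reflect x"] by auto
    then show ?thesis by (simp add: set_lebesgue_integral_def indicator_def)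
  qed
  finally show ?thesis ..
qed

text \<open>Energy and measure are reflection invariant, and reflected test functions are again test
  functions.\<close>

lemma has_laplacian_reflect:
  assumes "has_laplacian u f"
  shows "has_laplacian (\<lambda>x. u (reflect x)) (\<lambda>x. f (reflect x))"
  unfolding has_laplacian_def
proof (intro conjI ballI impI)
  note d = has_laplacian_dom[OF assms] and c = has_laplacian_continuous[OF assms]
  show "(\<lambda>x. u (reflect x)) \<in> dom_energy" by (rule dom_energy_reflect[OF d])
  show cr: "continuous_on SG (\<lambda>x. f (reflect x))"
    by (auto intro!: continuous_on_compose2[OF c] continuous_intros reflect_SG)
  fix v assume v: "v \<in> dom_energy" "\<forall>x\<in>V0. v x = 0"
  let ?v = "\<lambda>x. v (reflect x)"
  have "energy (\<lambda>x. u (reflect x)) v = energy u ?v"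
    using energy_reflect[of u ?v] by simp
  also have "\<dots> = - L2_inner f ?v"
    by (rule has_laplacian_test[OF assms dom_energy_reflect[OF v(1)]])
      (use reflect_V[of _ 0] v in auto)
  also have "L2_inner f ?v = (LINT x:SG|\<mu>. f (reflect x) * v x)"
    using SG_integral_reflect[of "\<lambda>x. f (reflect x) * v x"] cr dom_energy_continuous[OF v(1)]
    by (simp add: L2_inner_def continuous_on_mult)
  finally show "energy (\<lambda>x. u (reflect x)) v = - (LINT x:SG|\<mu>. f (reflect x) * v x)" .
qed

lemma reflect_iterate_F: "reflect ((F 0 ^^ r) x) = (F 0 ^^ r) (reflect x)"
  by (induction r) (auto simp: reflect_F swap12_def)

lemma has_normal_deriv_reflect:
  "has_normal_deriv u D 0 \<Longrightarrow> has_normal_deriv (\<lambda>x. u (reflect x)) D 0"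
  by (simp add: has_normal_deriv_0_iff reflect_iterate_F reflect_q swap12_def algebra_simps del: One_nat_def)

lemma has_tangential_deriv_reflect:
  assumes "has_tangential_deriv u D 0"
  shows "has_tangential_deriv (\<lambda>x. u (reflect x)) (- D) 0"
  using tendsto_minus[OF assms[unfolded has_tangential_deriv_0_iff]]
  by (simp add: has_tangential_deriv_0_iff reflect_iterate_F reflect_q swap12_def algebra_simps del: One_nat_def)

section \<open>Gram-Schmidt for forms on polynomials\<close>

text \<open>The recursion of \<open>gram_schmidt\<close> carried out on coefficients, with
  \<open>monom 1 n\<close> standing for the n-th monomial, so that degree and leading coefficient
  are available.\<close>

fun gs_poly :: "(real poly \<Rightarrow> real poly \<Rightarrow> real) \<Rightarrow> nat \<Rightarrow> real poly" where
  "gs_poly B n = monom 1 n -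
     (\<Sum>i<n. smult (B (monom 1 n) (gs_poly B i) / B (gs_poly B i) (gs_poly B i)) (gs_poly B i))"

declare gs_poly.simps [simp del]

lemma degree_gs_poly_le: "degree (gs_poly B n) \<le> n"
proof (induction n rule: less_induct)
  case (less n)
  have "degree (\<Sum>i<n. smult (B (monom 1 n) (gs_poly B i) / B (gs_poly B i) (gs_poly B i)) (gs_poly B i)) \<le> n"
  proof (rule degree_sum_le)
    fix i assume "i \<in> {..<n}"
    then have "degree (gs_poly B i) \<le> n" using less[of i] by simp
    then show "degree (smult (B (monom 1 n) (gs_poly B i) / B (gs_poly B i) (gs_poly B i)) (gs_poly B i)) \<le> n"
      using degree_smult_le order_trans by blast
  qed simp
  then show ?case
    by (subst gs_poly.simps) (intro degree_diff_le degree_monom_le)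
qed

lemma coeff_gs_poly: "coeff (gs_poly B n) n = 1"
proof -
  have "coeff (gs_poly B i) n = 0" if "i < n" for i
    using degree_gs_poly_le[of B i] that by (intro coeff_eq_0) simp
  then show ?thesis by (subst gs_poly.simps) (simp add: coeff_sum)
qed

lemma gs_poly_nonzero: "gs_poly B n \<noteq> 0"
  using coeff_gs_poly[of B n] by auto

locale pos_form =
  fixes B :: "real poly \<Rightarrow> real poly \<Rightarrow> real"
  assumes sym: "B c d = B d c"
    and add_left: "B (c + c') d = B c d + B c' d"
    and smult_left: "B (smult a c) d = a * B c d"
    and pos: "c \<noteq> 0 \<Longrightarrow> B c c > 0"
begin

lemma zero_left: "B 0 d = 0"
  using smult_left[of 0 0 d] by simp

lemma sum_left: "B (\<Sum>i\<in>A. c i) d = (\<Sum>i\<in>A. B (c i) d)"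
  by (induction A rule: infinite_finite_induct) (auto simp: zero_left add_left)

lemma diff_left: "B (c - c') d = B c d - B c' d"
  using add_left[of c "smult (-1) c'" d] by (simp only: smult_left) simp

lemma gs_pos: "B (gs_poly B n) (gs_poly B n) > 0"
  by (rule pos[OF gs_poly_nonzero])

lemma gs_orthogonal_less: "i < n \<Longrightarrow> B (gs_poly B n) (gs_poly B i) = 0"
proof (induction n arbitrary: i rule: less_induct)
  case (less n)
  have "B (gs_poly B n) (gs_poly B i) = B (monom 1 n) (gs_poly B i) -
      (\<Sum>j<n. B (monom 1 n) (gs_poly B j) / B (gs_poly B j) (gs_poly B j) * B (gs_poly B j) (gs_poly B i))"
    by (subst (1) gs_poly.simps) (simp add: diff_left sum_left smult_left)
  also have "(\<Sum>j<n. B (monom 1 n) (gs_poly B j) / B (gs_poly B j) (gs_poly B j) * B (gs_poly B j) (gs_poly B i))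
      = (\<Sum>j<n. if j = i then B (monom 1 n) (gs_poly B i) else 0)"
  proof (intro sum.cong refl)
    fix j assume "j \<in> {..<n}"
    then have "B (gs_poly B j) (gs_poly B i) = 0" if "j \<noteq> i"
      using that less sym[of "gs_poly B j" "gs_poly B i"] by (cases "j < i") auto
    then show "B (monom 1 n) (gs_poly B j) / B (gs_poly B j) (gs_poly B j) * B (gs_poly B j) (gs_poly B i)
        = (if j = i then B (monom 1 n) (gs_poly B i) else 0)"
      using gs_pos[of i] by simp
  qed
  finally show ?case using less.prems by simp
qed

lemma gs_orthogonal: "i \<noteq> j \<Longrightarrow> B (gs_poly B i) (gs_poly B j) = 0"
  using gs_orthogonal_less[of i j] gs_orthogonal_less[of j i] sym by (cases "i < j") auto

lemma gs_spans:
  "degree c \<le> N \<Longrightarrow> \<exists>a. c = (\<Sum>i\<le>N. smult (a i) (gs_poly B i))"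
proof (induction N arbitrary: c)
  case 0
  then obtain a where "c = [:a:]" by (metis degree_eq_zeroE le_zero_eq)
  moreover have "gs_poly B 0 = 1"
    by (subst gs_poly.simps) (simp add: monom_0)
  ultimately show ?case by (intro exI[of _ "\<lambda>_. a"]) simp
next
  case (Suc N)
  \<comment> \<open>The basis is monic with one element per degree: subtracting the right multiple
    of the top one lowers the degree.\<close>
  define d where "d = c - smult (coeff c (Suc N)) (gs_poly B (Suc N))"
  have "degree d \<le> Suc N"
    unfolding d_def using Suc.prems degree_gs_poly_le[of B "Suc N"]
    by (intro degree_diff_le order_trans[OF degree_smult_le])
  moreover have "coeff d (Suc N) = 0" by (simp add: d_def coeff_gs_poly)
  ultimately have "coeff d i = 0" if "i > N" for i
    using that by (cases "i = Suc N") (auto intro: coeff_eq_0)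
  then have "degree d \<le> N" by (intro degree_le) simp
  then obtain a where "d = (\<Sum>i\<le>N. smult (a i) (gs_poly B i))" using Suc.IH by blast
  then have "c = (\<Sum>i\<le>N. smult (a i) (gs_poly B i)) + smult (coeff c (Suc N)) (gs_poly B (Suc N))"
    by (simp add: d_def)
  also have "\<dots> = (\<Sum>i\<le>Suc N. smult ((a(Suc N := coeff c (Suc N))) i) (gs_poly B i))"
    by (simp add: atMost_Suc)
  finally show ?case by blast
qed

lemma gs_expansion:
  assumes "degree c \<le> N"
  shows "c = (\<Sum>i\<le>N. smult (B c (gs_poly B i) / B (gs_poly B i) (gs_poly B i)) (gs_poly B i))"
proof -
  obtain a where a: "c = (\<Sum>i\<le>N. smult (a i) (gs_poly B i))" using gs_spans[OF assms] by blast
  have "B c (gs_poly B j) = a j * B (gs_poly B j) (gs_poly B j)" if "j \<le> N" for j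
  proof -
    have "B c (gs_poly B j) = (\<Sum>i\<le>N. if i = j then a j * B (gs_poly B j) (gs_poly B j) else 0)"
      unfolding a sum_left smult_left by (intro sum.cong refl) (simp add: gs_orthogonal)
    then show ?thesis using that by simp
  qed
  then have "a j = B c (gs_poly B j) / B (gs_poly B j) (gs_poly B j)" if "j \<le> N" for j
    using that gs_pos[of j] by (simp add: field_simps)
  then show ?thesis by (subst a) (intro sum.cong refl, simp)
qed

lemma gs_orthogonal_low_degree:
  assumes "degree c < n"
  shows "B c (gs_poly B n) = 0"
proof -
  have "degree c \<le> n - 1" using assms by simp
  then obtain a where a: "c = (\<Sum>i\<le>n - 1. smult (a i) (gs_poly B i))"
    using gs_spans by blast
  show ?thesis
    unfolding a sum_left smult_left using assms by (intro sum.neutral) (auto simp: gs_orthogonal)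
qed

end

section \<open>The polynomials spanned by the monomials of one family\<close>

lemma is_monomialD:
  assumes "is_monomial j k u"
  shows "has_laplacian u (laplacian u)" "u (q 0) = of_bool (0 = j \<and> k = 1)"
    "has_normal_deriv u (of_bool (0 = j \<and> k = 2)) 0" "has_tangential_deriv u (of_bool (0 = j \<and> k = 3)) 0"
proof -
  have "\<exists>f. has_laplacian u f"
    using assms by (auto simp: is_monomial_def dom_laplacian_pow_def dest!: spec[of _ 0])
  then show "has_laplacian u (laplacian u)" using has_laplacian_laplacian by blast
  show "u (q 0) = of_bool (0 = j \<and> k = 1)"
    "has_normal_deriv u (of_bool (0 = j \<and> k = 2)) 0" "has_tangential_deriv u (of_bool (0 = j \<and> k = 3)) 0"
    using assms unfolding is_monomial_def by (auto dest!: spec[of _ 0])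
qed

lemma is_monomial_laplacian:
  assumes "is_monomial (Suc j) k u"
  shows "is_monomial j k (laplacian u)"
  unfolding is_monomial_def
proof (intro conjI ballI allI impI)
  have sw: "(laplacian ^^ n) (laplacian u) = (laplacian ^^ Suc n) u" for n
    by (simp add: funpow_swap1)
  show "laplacian u \<in> dom_laplacian_pow (j + 1)"
    using assms by (auto simp: is_monomial_def dom_laplacian_pow_def sw simp del: funpow.simps)
  show "(laplacian ^^ (j + 1)) (laplacian u) x = 0" if "x \<in> SG" for x
    using assms that by (simp add: is_monomial_def sw del: funpow.simps)
  fix n assume "n \<le> j"
  then have "Suc n \<le> Suc j" by simp
  with assms have "(laplacian ^^ Suc n) u (q 0) = of_bool (Suc n = Suc j \<and> k = 1) \<and>
             has_normal_deriv ((laplacian ^^ Suc n) u) (of_bool (Suc n = Suc j \<and> k = 2)) 0 \<and>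
             has_tangential_deriv ((laplacian ^^ Suc n) u) (of_bool (Suc n = Suc j \<and> k = 3)) 0"
    unfolding is_monomial_def by blast
  then show "(laplacian ^^ n) (laplacian u) (q 0) = of_bool (n = j \<and> k = 1)"
    "has_normal_deriv ((laplacian ^^ n) (laplacian u)) (of_bool (n = j \<and> k = 2)) 0"
    "has_tangential_deriv ((laplacian ^^ n) (laplacian u)) (of_bool (n = j \<and> k = 3)) 0"
    unfolding sw by auto
qed

lemma is_monomial_0_laplacian: "is_monomial 0 k u \<Longrightarrow> x \<in> SG \<Longrightarrow> laplacian u x = 0"
  by (simp add: is_monomial_def)

text \<open>By induction the Laplacians agree; value, normal and tangential derivative at
  \<open>q 0\<close> then determine the function.\<close>

lemma is_monomial_unique:
  "is_monomial j k u \<Longrightarrow> is_monomial j k v \<Longrightarrow> x \<in> SG \<Longrightarrow> u x = v x"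
proof (induction j arbitrary: u v x)
  case 0
  note u = is_monomialD[OF 0(1)] and v = is_monomialD[OF 0(2)]
  show ?case
  proof (rule cauchy_data_unique[OF u(1,3,4) v(1,3,4) _ _ 0(3)])
    show "laplacian u y = laplacian v y" if "y \<in> SG" for y
      using is_monomial_0_laplacian[OF _ that] 0 by simp
    show "u (q 0) = v (q 0)" using u(2) v(2) by simp
  qed
next
  case (Suc j)
  note u = is_monomialD[OF Suc.prems(1)] and v = is_monomialD[OF Suc.prems(2)]
  show ?case
  proof (rule cauchy_data_unique[OF u(1,3,4) v(1,3,4) _ _ Suc.prems(3)])
    show "laplacian u y = laplacian v y" if "y \<in> SG" for y
      by (rule Suc.IH[OF is_monomial_laplacian[OF Suc.prems(1)]
            is_monomial_laplacian[OF Suc.prems(2)] that])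
    show "u (q 0) = v (q 0)" using u(2) v(2) by simp
  qed
qed

lemma has_laplacian_zero: "has_laplacian (\<lambda>x. 0) (\<lambda>x. 0)"
  using has_laplacian_lincomb[OF has_laplacian_hfun has_laplacian_hfun, of 0 _ 0] by simp

lemma has_laplacian_sum:
  "finite A \<Longrightarrow> (\<And>i. i \<in> A \<Longrightarrow> has_laplacian (u i) (f i)) \<Longrightarrow>
    has_laplacian (\<lambda>x. \<Sum>i\<in>A. a i * u i x) (\<lambda>x. \<Sum>i\<in>A. a i * f i x)"
proof (induction rule: finite_induct)
  case empty
  show ?case using has_laplacian_zero by simp
next
  case (insert i A)
  have "has_laplacian (\<lambda>x. a i * u i x + 1 * (\<Sum>i\<in>A. a i * u i x))
      (\<lambda>x. a i * f i x + 1 * (\<Sum>i\<in>A. a i * f i x))"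
    using insert by (intro has_laplacian_lincomb) auto
  then show ?case using insert by simp
qed

section \<open>One family, its symmetry type and its coding by polynomials\<close>

locale monomial_family =
  fixes k :: nat and P :: "nat \<Rightarrow> plane \<Rightarrow> real"
  assumes k: "k = 2 \<or> k = 3"
    and monomial: "is_monomial j k (P j)"
begin

lemma laplacian_P_0: "has_laplacian (P 0) (\<lambda>x. 0)"
  using is_monomialD(1)[OF monomial[of 0]] has_laplacian_cong[of "P 0" "P 0" "laplacian (P 0)" "\<lambda>x. 0"]
    is_monomial_0_laplacian[OF monomial[of 0]] by simp

lemma laplacian_P_Suc: "has_laplacian (P (Suc j)) (P j)"
proof -
  have "laplacian (P (Suc j)) x = P j x" if "x \<in> SG" for x
    by (rule is_monomial_unique[OF is_monomial_laplacian[OF monomial] monomial that])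
  then show ?thesis
    using is_monomialD(1)[OF monomial[of "Suc j"]]
      has_laplacian_cong[of "P (Suc j)" "P (Suc j)" "laplacian (P (Suc j))" "P j"] by simp
qed

lemma P_q0: "P j (q 0) = 0"
  using is_monomialD(2)[OF monomial[of j]] k by auto

text \<open>Reflection preserves the normal derivative at \<open>q 0\<close> and negates the
  tangential one: the family k = 2 is even, the family k = 3 odd.\<close>

definition parity :: real where
  "parity = (if k = 2 then 1 else - 1)"

text \<open>Both sides solve the same Cauchy problem at \<open>q 0\<close>. The sign is absorbed by
  the single datum equal to 1, all others being 0.\<close>

lemma P_reflect: "x \<in> SG \<Longrightarrow> P j x = parity * P j (reflect x)"
proof (induction j arbitrary: x)
  case 0
  note d = is_monomialD[OF monomial[of 0]]
  show ?case
  proof (rule cauchy_data_unique[OF laplacian_P_0 d(3,4) _ _ _ _ _ 0])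
    show "has_laplacian (\<lambda>x. parity * P 0 (reflect x)) (\<lambda>x. 0)"
      using has_laplacian_lincomb[OF has_laplacian_reflect[OF laplacian_P_0]
          has_laplacian_reflect[OF laplacian_P_0], of parity 0] by simp
    show "has_normal_deriv (\<lambda>x. parity * P 0 (reflect x)) (of_bool (0 = (0::nat) \<and> k = 2)) 0"
      using has_normal_deriv_lincomb[OF has_normal_deriv_reflect[OF d(3)]
          has_normal_deriv_reflect[OF d(3)], of parity 0] k by (auto simp: parity_def)
    show "has_tangential_deriv (\<lambda>x. parity * P 0 (reflect x)) (of_bool (0 = (0::nat) \<and> k = 3)) 0"
      using has_tangential_deriv_lincomb[OF has_tangential_deriv_reflect[OF d(4)]
          has_tangential_deriv_reflect[OF d(4)], of parity 0] k by (auto simp: parity_def)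
    show "P 0 (q 0) = parity * P 0 (reflect (q 0))"
      by (simp add: reflect_q swap12_def P_q0)
  qed simp
next
  case (Suc j)
  note d = is_monomialD[OF monomial[of "Suc j"]]
  show ?case
  proof (rule cauchy_data_unique[OF laplacian_P_Suc d(3,4) _ _ _ _ _ Suc.prems])
    show "has_laplacian (\<lambda>x. parity * P (Suc j) (reflect x)) (\<lambda>x. parity * P j (reflect x))"
      using has_laplacian_lincomb[OF has_laplacian_reflect[OF laplacian_P_Suc[of j]]
          has_laplacian_reflect[OF laplacian_P_Suc[of j]], of parity 0] by simp
    show "has_normal_deriv (\<lambda>x. parity * P (Suc j) (reflect x)) (of_bool (0 = Suc j \<and> k = 2)) 0"
      using has_normal_deriv_lincomb[OF has_normal_deriv_reflect[OF d(3)]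
          has_normal_deriv_reflect[OF d(3)], of parity 0] by simp
    show "has_tangential_deriv (\<lambda>x. parity * P (Suc j) (reflect x)) (of_bool (0 = Suc j \<and> k = 3)) 0"
      using has_tangential_deriv_lincomb[OF has_tangential_deriv_reflect[OF d(4)]
          has_tangential_deriv_reflect[OF d(4)], of parity 0] by simp
    show "P (Suc j) (q 0) = parity * P (Suc j) (reflect (q 0))"
      by (simp add: reflect_q swap12_def P_q0)
  qed (rule Suc.IH)
qed

lemma P_q1: "P j (q 1) = parity * P j (q 2)"
  using P_reflect[OF q_in_SG[of 1]] reflect_q[of 1] by (simp add: swap12_def del: One_nat_def)

text \<open>Otherwise \<open>P 0\<close> would vanish on all of \<open>V0\<close>, hence on
  \<open>SG\<close>, contradicting the derivative normalized to 1. This number is the divisor in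
  \<open>green_poly\<close> below.\<close>

lemma P_0_q2: "P 0 (q 2) \<noteq> 0"
proof
  assume z: "P 0 (q 2) = 0"
  have "P 0 x = 0" if "x \<in> V0" for x
  proof -
    from that obtain i where "i < 3" "x = q i" by (auto simp: V0_def)
    then show ?thesis using z P_q0[of 0] P_q1[of 0] unfolding less_3_iff by auto
  qed
  then have "P 0 x = 0" if "x \<in> SG" for x
    using zero_boundary_unique[OF laplacian_P_0 has_laplacian_zero _ that] by simp
  then have *: "has_normal_deriv (P 0) D 0 \<longleftrightarrow> D = 0" "has_tangential_deriv (P 0) D 0 \<longleftrightarrow> D = 0" for D
    using has_normal_deriv_cong[of "P 0" "\<lambda>x. 0" D] has_tangential_deriv_cong[of "P 0" "\<lambda>x. 0" D]
    by (auto simp: has_normal_deriv_def has_tangential_deriv_def LIMSEQ_const_iff)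
  show False
    using is_monomialD(3,4)[OF monomial[of 0]] k unfolding * by auto
qed

lemma continuous_P: "continuous_on SG (P j)"
  using is_monomialD(1)[OF monomial[of j]] by (intro dom_energy_continuous has_laplacian_dom)

definition pol :: "real poly \<Rightarrow> plane \<Rightarrow> real" where
  "pol c x = (\<Sum>i\<le>degree c. coeff c i * P i x)"

lemma pol_eq: "degree c \<le> N \<Longrightarrow> pol c x = (\<Sum>i\<le>N. coeff c i * P i x)"
  unfolding pol_def by (rule sum.mono_neutral_left) (auto simp: coeff_eq_0)

lemma pol_0 [simp]: "pol 0 x = 0"
  by (simp add: pol_def)

lemma pol_add: "pol (c + d) x = pol c x + pol d x"
  using pol_eq[of c "max (degree c) (degree d)" x] pol_eq[of d "max (degree c) (degree d)" x]
    pol_eq[OF degree_add_le_max, of c d x]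
  by (simp add: distrib_right sum.distrib)

lemma pol_smult: "pol (smult a c) x = a * pol c x"
  using pol_eq[OF degree_smult_le, of a c x] by (simp add: pol_def sum_distrib_left mult.assoc)

lemma pol_diff: "pol (c - d) x = pol c x - pol d x"
  using pol_add[of c "smult (-1) d" x] by (simp only: pol_smult) simp

lemma pol_sum: "pol (\<Sum>i\<in>A. c i) x = (\<Sum>i\<in>A. pol (c i) x)"
  by (induction A rule: infinite_finite_induct) (auto simp: pol_add)

lemma pol_monom: "pol (monom 1 n) x = P n x"
proof -
  have "pol (monom 1 n) x = (\<Sum>i\<le>n. if i = n then P n x else 0)"
    unfolding pol_eq[OF degree_monom_le] by (intro sum.cong) auto
  then show ?thesis by simp
qed

lemma pol_pCons: "pol (pCons a c) x = a * P 0 x + pol (pCons 0 c) x"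
proof -
  have "pCons a c = smult a (monom 1 0) + pCons 0 c" by (simp add: monom_0)
  then show ?thesis by (simp only: pol_add pol_smult pol_monom)
qed

lemma continuous_pol: "continuous_on SG (pol c)"
  unfolding pol_def[abs_def] by (intro continuous_intros continuous_P)

lemma pol_q0: "pol c (q 0) = 0"
  by (simp add: pol_def P_q0)

lemma pol_q1: "pol c (q 1) = parity * pol c (q 2)"
  unfolding pol_def P_q1 by (simp add: sum_distrib_left mult_ac)

lemma has_laplacian_pol: "has_laplacian (pol c) (pol (poly_shift 1 c))"
proof -
  define N where "N = degree c"
  let ?f = "\<lambda>i. case i of 0 \<Rightarrow> (\<lambda>x. 0) | Suc j \<Rightarrow> P j"
  \<comment> \<open>Summing one index beyond the degree lets the zero term for \<open>P 0\<close> be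
    split off, leaving a sum up to \<open>N\<close> for the shifted coefficients.\<close>
  have "has_laplacian (\<lambda>x. \<Sum>i\<le>Suc N. coeff c i * P i x) (\<lambda>x. \<Sum>i\<le>Suc N. coeff c i * ?f i x)"
    by (rule has_laplacian_sum) (auto simp: laplacian_P_0 laplacian_P_Suc split: nat.split)
  moreover have "(\<lambda>x. \<Sum>i\<le>Suc N. coeff c i * P i x) = pol c"
    using pol_eq[of c "Suc N"] by (simp add: N_def fun_eq_iff)
  moreover have "degree (poly_shift 1 c) \<le> N"
    by (rule degree_le) (auto simp: coeff_poly_shift N_def intro!: coeff_eq_0)
  then have "(\<lambda>x. \<Sum>i\<le>Suc N. coeff c i * ?f i x) = pol (poly_shift 1 c)"
    unfolding sum.atMost_Suc_shift by (simp add: fun_eq_iff pol_eq coeff_poly_shift)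
  ultimately show ?thesis by simp
qed

lemma laplacian_pow_pol: "x \<in> SG \<Longrightarrow> (laplacian ^^ l) (pol c) x = pol (poly_shift l c) x"
proof (induction l arbitrary: c x)
  case 0
  show ?case by simp
next
  case (Suc l)
  have "(laplacian ^^ Suc l) (pol c) x = (laplacian ^^ l) (laplacian (pol c)) x"
    by (simp add: funpow_swap1)
  also have "\<dots> = (laplacian ^^ l) (pol (poly_shift 1 c)) x"
    by (rule laplacian_pow_cong[OF laplacian_eq[OF has_laplacian_pol] Suc.prems])
  also have "\<dots> = pol (poly_shift l (poly_shift 1 c)) x" by (rule Suc.IH[OF Suc.prems])
  also have "poly_shift l (poly_shift 1 c) = poly_shift (Suc l) c"
    by (rule poly_eqI) (simp add: coeff_poly_shift)
  finally show ?case .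
qed

text \<open>Linear independence of the monomials on \<open>SG\<close>: applying the Laplacian as
  often as the degree leaves the leading coefficient times \<open>P 0\<close>, which is nonzero at
  \<open>q 2\<close>. It makes the L2 form on coefficients positive definite.\<close>

lemma pol_eq_0:
  assumes "\<And>x. x \<in> SG \<Longrightarrow> pol c x = 0"
  shows "c = 0"
proof (rule ccontr)
  assume "c \<noteq> 0"
  define n where "n = degree c"
  have q2: "q 2 \<in> SG" by (simp add: q_in_SG)
  have "poly_shift n c = smult (coeff c n) (monom 1 0)"
    by (rule poly_eqI) (auto simp: coeff_poly_shift n_def monom_0 coeff_pCons intro!: coeff_eq_0 split: nat.split)
  then have "coeff c n * P 0 (q 2) = (laplacian ^^ n) (pol c) (q 2)"
    using laplacian_pow_pol[OF q2] by (simp only: pol_smult pol_monom)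
  also have "\<dots> = (laplacian ^^ n) (pol 0) (q 2)"
    by (rule laplacian_pow_cong[OF _ q2]) (simp add: assms)
  also have "\<dots> = 0" using laplacian_pow_pol[OF q2, of n 0] by simp
  finally show False using P_0_q2 \<open>c \<noteq> 0\<close> by (simp add: n_def)
qed

text \<open>Since the symmetry type makes every polynomial proportional to \<open>P 0\<close> on \<open>V0\<close>, the
  harmonic correction in the Green operator is a multiple of \<open>P 0\<close>.\<close>

definition green_poly :: "real poly \<Rightarrow> real poly" where
  "green_poly c = pCons (- pol (pCons 0 c) (q 2) / P 0 (q 2)) c"

lemma pol_green_poly_V0: "x \<in> V0 \<Longrightarrow> pol (green_poly c) x = 0"
proof -
  assume "x \<in> V0"
  then obtain i where i: "i < 3" "x = q i" by (auto simp: V0_def)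
  have "pol (green_poly c) (q 2) = 0"
    unfolding green_poly_def by (subst pol_pCons) (simp add: P_0_q2)
  then show ?thesis using i pol_q0 pol_q1[of "green_poly c"] unfolding less_3_iff by auto
qed

lemma has_laplacian_green_poly: "has_laplacian (pol (green_poly c)) (pol c)"
proof -
  have "poly_shift 1 (green_poly c) = c"
    by (rule poly_eqI) (simp add: coeff_poly_shift green_poly_def)
  then show ?thesis using has_laplacian_pol[of "green_poly c"] by simp
qed

lemma green_pow_pol: "x \<in> SG \<Longrightarrow> (green ^^ n) (pol c) x = pol ((green_poly ^^ n) c) x"
proof (induction n arbitrary: x)
  case (Suc n)
  have "(green ^^ Suc n) (pol c) x = green (pol ((green_poly ^^ n) c)) x"
    using green_cong[of "(green ^^ n) (pol c)" "pol ((green_poly ^^ n) c)"] Suc.IH by simp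
  also have "\<dots> = pol (green_poly ((green_poly ^^ n) c)) x"
    by (rule green_eq[OF has_laplacian_green_poly pol_green_poly_V0 Suc.prems])
  finally show ?case by simp
qed simp

lemma coeff_green_poly_pow: "coeff ((green_poly ^^ n) c) (i + n) = coeff c i"
  by (induction n) (auto simp: green_poly_def)

lemma degree_green_poly_pow: "degree ((green_poly ^^ n) c) \<le> degree c + n"
proof (rule degree_le, intro allI impI)
  fix i assume i: "i > degree c + n"
  then show "coeff ((green_poly ^^ n) c) i = 0"
    using coeff_green_poly_pow[of n c "i - n"] by (simp add: coeff_eq_0)
qed

text \<open>Each Laplacian undoes one Green operator; the prepended coefficients are exactly those
  that the shift discards.\<close>

lemma poly_shift_green_pow:
  assumes "l \<le> n"
  shows "poly_shift l ((green_poly ^^ n) c) = (green_poly ^^ (n - l)) c"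
proof (rule poly_eqI)
  have "(green_poly ^^ n) c = (green_poly ^^ l) ((green_poly ^^ (n - l)) c)"
    using assms by (simp flip: funpow_add o_apply[of "green_poly ^^ l"])
  then show "coeff (poly_shift l ((green_poly ^^ n) c)) i = coeff ((green_poly ^^ (n - l)) c) i" for i
    by (simp add: coeff_poly_shift coeff_green_poly_pow)
qed

definition L2_form :: "real poly \<Rightarrow> real poly \<Rightarrow> real" where
  "L2_form c d = L2_inner (pol c) (pol d)"

lemma L2_form_green: "L2_form ((green_poly ^^ n) c) d = L2_form c ((green_poly ^^ n) d)"
proof (induction n arbitrary: c d)
  case (Suc n)
  have one: "L2_form (green_poly c) d = L2_form c (green_poly d)" for c d
    unfolding L2_form_def
    by (rule L2_inner_laplacian_symmetric[OF has_laplacian_green_poly pol_green_poly_V0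
          has_laplacian_green_poly pol_green_poly_V0])
  show ?case using one Suc.IH by (simp add: funpow_swap1)
qed simp

sublocale L2: pos_form L2_form
proof
  fix c d e :: "real poly" and a :: real
  show "L2_form c d = L2_form d c" by (simp add: L2_form_def L2_inner_commute)
  have lin: "L2_form (smult a c + smult b e) d = a * L2_form c d + b * L2_form e d" for a b c d e
    using L2_inner_lincomb_left[OF continuous_pol continuous_pol continuous_pol, of a c b e d]
    unfolding L2_form_def pol_add[abs_def] pol_smult .
  show "L2_form (c + e) d = L2_form c d + L2_form e d" using lin[of 1 c 1 e d] by simp
  show "L2_form (smult a c) d = a * L2_form c d" using lin[of a c 0 0 d] by simp
  assume "c \<noteq> 0"
  then obtain x where "x \<in> SG" "pol c x \<noteq> 0" using pol_eq_0 by blast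
  then show "L2_form c c > 0" unfolding L2_form_def by (rule L2_inner_pos[OF continuous_pol])
qed

lemma L2_form_nonneg: "L2_form c c \<ge> 0"
  using L2.pos[of c] L2.zero_left[of 0] by (cases "c = 0") auto

lemma gram_schmidt_pol:
  "gram_schmidt ip P n = pol (gs_poly (\<lambda>c d. ip (pol c) (pol d)) n)"
proof (induction n rule: less_induct)
  case (less n)
  let ?g = "gs_poly (\<lambda>c d. ip (pol c) (pol d))"
  have monom: "pol (monom 1 n) = P n" by (simp add: fun_eq_iff pol_monom)
  show ?case
  proof
    fix x
    have "gram_schmidt ip P n x = P n x -
        (\<Sum>i<n. ip (P n) (pol (?g i)) / ip (pol (?g i)) (pol (?g i)) * pol (?g i) x)"
      by (subst gram_schmidt.simps, intro arg_cong2[where f = "(-)"] refl sum.cong) (simp add: less)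
    also have "\<dots> = pol (?g n) x"
      by (subst (4) gs_poly.simps) (simp add: pol_diff pol_sum pol_smult monom)
    finally show "gram_schmidt ip P n x = pol (?g n) x" .
  qed
qed

lemma legendre_pol: "legendre P n = pol (gs_poly L2_form n)"
  unfolding legendre_def gram_schmidt_pol L2_form_def[abs_def] ..

end

section \<open>The Sobolev form and its representing polynomial\<close>

locale sobolev_family = monomial_family +
  fixes m :: nat and chi :: "nat \<Rightarrow> real"
  assumes chi_0: "chi 0 = 1" and chi_nonneg: "l \<le> m \<Longrightarrow> chi l \<ge> 0"
begin

definition S_form :: "real poly \<Rightarrow> real poly \<Rightarrow> real" where
  "S_form c d = (\<Sum>l\<le>m. chi l * L2_form (poly_shift l c) (poly_shift l d))"

lemma sobolev_inner_pol:
  assumes "\<And>x. x \<in> SG \<Longrightarrow> f x = pol c x" "\<And>x. x \<in> SG \<Longrightarrow> g x = pol d x"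
  shows "sobolev_inner m chi f g = S_form c d"
  unfolding sobolev_inner_def S_form_def L2_form_def
  using laplacian_pow_cong[of f "pol c"] laplacian_pow_cong[of g "pol d"] assms
  by (intro sum.cong arg_cong2[where f = "(*)"] refl L2_inner_cong) (simp_all add: laplacian_pow_pol)

lemma sobolev_pol: "sobolev m chi P n = pol (gs_poly S_form n)"
proof -
  have "(\<lambda>c d. sobolev_inner m chi (pol c) (pol d)) = S_form"
    by (intro ext sobolev_inner_pol) auto
  then show ?thesis by (simp add: sobolev_def gram_schmidt_pol)
qed

sublocale S: pos_form S_form
proof
  fix c d e :: "real poly" and a :: real
  have ps: "poly_shift l (c + e) = poly_shift l c + poly_shift l e"
    "poly_shift l (smult a c) = smult a (poly_shift l c)" for l
    by (rule poly_eqI; simp add: coeff_poly_shift)+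
  show "S_form c d = S_form d c" by (simp add: S_form_def L2.sym[of "poly_shift _ c"])
  show "S_form (c + e) d = S_form c d + S_form e d"
    by (simp add: S_form_def ps L2.add_left distrib_left sum.distrib)
  show "S_form (smult a c) d = a * S_form c d"
    by (simp add: S_form_def ps L2.smult_left sum_distrib_left mult_ac)
  assume "c \<noteq> 0"
  \<comment> \<open>The term \<open>l = 0\<close> is the L2 form itself, with weight 1; the
    remaining terms can only add.\<close>
  then have "0 < chi 0 * L2_form (poly_shift 0 c) (poly_shift 0 c)"
    using L2.pos[of c] chi_0 by simp
  also have "\<dots> \<le> S_form c c"
    unfolding S_form_def
    by (rule member_le_sum) (auto intro!: mult_nonneg_nonneg chi_nonneg L2_form_nonneg)
  finally show "S_form c c > 0" .
qed

text \<open>By self-adjointness of the Green operator, this polynomial represents the functional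
  \<open>c \<mapsto> S_form ((green_poly ^^ m) c) s\<close> in \<open>L2_form\<close>.\<close>

definition repr :: "real poly \<Rightarrow> real poly" where
  "repr s = (\<Sum>l\<le>m. smult (chi l) ((green_poly ^^ (m - l)) (poly_shift l s)))"

lemma S_form_green: "S_form ((green_poly ^^ m) c) s = L2_form (repr s) c"
proof -
  have "S_form ((green_poly ^^ m) c) s =
      (\<Sum>l\<le>m. chi l * L2_form ((green_poly ^^ (m - l)) c) (poly_shift l s))"
    unfolding S_form_def by (intro sum.cong) (auto simp: poly_shift_green_pow)
  also have "\<dots> = (\<Sum>l\<le>m. chi l * L2_form ((green_poly ^^ (m - l)) (poly_shift l s)) c)"
    by (intro sum.cong arg_cong2[where f = "(*)"] refl)
      (metis L2_form_green L2.sym)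
  finally show ?thesis by (simp add: repr_def L2.sum_left L2.smult_left)
qed

text \<open>In the l-th term, m Laplacians meet m - l Green operators, and the l that are left over
  join the l already applied to \<open>s\<close>.\<close>

lemma poly_shift_repr: "poly_shift m (repr s) = (\<Sum>l\<le>m. smult (chi l) (poly_shift (2 * l) s))"
proof (rule poly_eqI)
  fix i
  have "coeff ((green_poly ^^ (m - l)) (poly_shift l s)) (i + m) = coeff s (i + 2 * l)" if "l \<le> m" for l
    using coeff_green_poly_pow[of "m - l" "poly_shift l s" "i + l"] that
    by (simp add: coeff_poly_shift add.assoc mult_2)
  then show "coeff (poly_shift m (repr s)) i = coeff (\<Sum>l\<le>m. smult (chi l) (poly_shift (2 * l) s)) i"
    by (simp add: repr_def coeff_poly_shift coeff_sum)
qed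

lemma degree_repr_le:
  assumes "degree s \<le> n"
  shows "degree (repr s) \<le> n + m"
  unfolding repr_def
proof (rule degree_sum_le)
  fix l assume "l \<in> {..m}"
  have "degree (poly_shift l s) \<le> n"
    using assms by (intro degree_le) (auto simp: coeff_poly_shift intro!: coeff_eq_0)
  then have "degree ((green_poly ^^ (m - l)) (poly_shift l s)) \<le> n + m"
    using degree_green_poly_pow[of "m - l" "poly_shift l s"] by simp
  then show "degree (smult (chi l) ((green_poly ^^ (m - l)) (poly_shift l s))) \<le> n + m"
    using degree_smult_le order_trans by blast
qed simp

text \<open>After the shift by \<open>m\<close>, the l-th term reads off the coefficient of
  \<open>s\<close> at \<open>n + 2 * l\<close>, beyond the degree bound unless \<open>l = 0\<close>;
  there the weight is \<open>chi 0\<close>, which is 1.\<close>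

lemma coeff_repr:
  assumes "degree s \<le> n"
  shows "coeff (repr s) (n + m) = coeff s n"
proof -
  have "coeff (repr s) (n + m) = coeff (poly_shift m (repr s)) n"
    by (simp add: coeff_poly_shift)
  also have "\<dots> = (\<Sum>l\<le>m. chi l * coeff s (n + 2 * l))"
    by (simp add: poly_shift_repr coeff_sum coeff_poly_shift)
  also have "\<dots> = (\<Sum>l\<le>m. if l = 0 then coeff s n else 0)"
    using assms chi_0 by (intro sum.cong) (auto simp: coeff_eq_0)
  finally show ?thesis by simp
qed

lemma repr_expansion:
  fixes n :: nat
  assumes "n \<ge> m"
  defines "s \<equiv> gs_poly S_form n" and "p \<equiv> gs_poly L2_form"
  shows "repr s = p (n + m) +
    (\<Sum>l=1..2*m. smult (S_form ((green_poly ^^ m) (p (n + m - l))) s / L2_form (p (n + m - l)) (p (n + m - l)))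
        (p (n + m - l)))"
proof -
  define a where "a i = L2_form (repr s) (p i) / L2_form (p i) (p i)" for i
  have deg: "degree s \<le> n" unfolding s_def by (rule degree_gs_poly_le)
  have expand: "repr s = (\<Sum>i\<le>n+m. smult (a i) (p i))"
    unfolding a_def p_def by (rule L2.gs_expansion[OF degree_repr_le[OF deg]])
  have "coeff (p i) (n + m) = 0" if "i < n + m" for i
    using degree_gs_poly_le[of L2_form i] that unfolding p_def by (intro coeff_eq_0) simp
  then have "coeff (repr s) (n + m) = (\<Sum>i\<le>n+m. if i = n + m then a (n + m) else 0)"
    unfolding expand coeff_sum coeff_smult
    by (intro sum.cong) (auto simp: p_def coeff_gs_poly)
  then have top: "a (n + m) = 1"
    using coeff_repr[OF deg] by (simp add: s_def coeff_gs_poly)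
  have low: "a i = 0" if "i + m < n" for i
  proof -
    have "degree ((green_poly ^^ m) (p i)) < n"
      using degree_green_poly_pow[of m "p i"] degree_gs_poly_le[of L2_form i] that
      unfolding p_def by linarith
    then show ?thesis
      using S.gs_orthogonal_low_degree S_form_green[of "p i" s] by (simp add: a_def s_def)
  qed
  \<comment> \<open>Reversed summation: from here on \<open>l\<close> counts downwards from the top
    degree \<open>n + m\<close>.\<close>
  have "repr s = (\<Sum>l\<le>n+m. smult (a (n + m - l)) (p (n + m - l)))"
    unfolding expand by (rule sum.reindex_bij_witness[of _ "\<lambda>i. n + m - i" "\<lambda>i. n + m - i"]) auto
  also have "{..n+m} = insert 0 {1..n+m}" by auto
  also have "(\<Sum>l\<in>insert 0 {1..n+m}. smult (a (n + m - l)) (p (n + m - l))) =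
      p (n + m) + (\<Sum>l=1..n+m. smult (a (n + m - l)) (p (n + m - l)))"
    by (simp add: top)
  \<comment> \<open>For \<open>l > 2 * m\<close> the index \<open>n + m - l\<close> lies below
    \<open>n - m\<close>, where the coefficients vanish; \<open>n \<ge> m\<close> ensures that the
    range up to \<open>2 * m\<close> is not longer than the full one.\<close>
  also have "(\<Sum>l=1..n+m. smult (a (n + m - l)) (p (n + m - l))) =
      (\<Sum>l=1..2*m. smult (a (n + m - l)) (p (n + m - l)))"
    using assms(1) by (intro sum.mono_neutral_right) (auto simp: low)
  finally show ?thesis unfolding a_def S_form_green .
qed

end

theorem theorem3p6:
  fixes m k n :: nat
    and chi :: "nat \<Rightarrow> real"
    and P :: "nat \<Rightarrow> plane \<Rightarrow> real"
  assumes "m \<ge> 2"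
    and "k = 2 \<or> k = 3"
    and "chi 0 = 1"
    and "\<And>l. 1 \<le> l \<Longrightarrow> l \<le> m \<Longrightarrow> chi l \<ge> 0"
    and "\<And>j. is_monomial j k (P j)"
    and "n \<ge> m"
  shows "\<forall>x\<in>SG.
    sobolev m chi P n x + (\<Sum>l=1..m. chi l * (laplacian ^^ (2 * l)) (sobolev m chi P n) x)
    = (laplacian ^^ m) (legendre P (n + m)) x
      + (\<Sum>l=1..2*m. d_sq P (n + m - l) * xi_inv_sq m chi P n
           * coeff_a m chi P (int n + int m - int l - 1) (2 * int m - int l - 1)
           * (laplacian ^^ m) (legendre P (n + m - l)) x)"
proof
  interpret sobolev_family k P m chi
  proof
    show "chi l \<ge> 0" if "l \<le> m" for l
      using assms(3) assms(4)[of l] that by (cases "l = 0") auto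
  qed (use assms in auto)
  fix x assume x: "x \<in> SG"
  define s where "s = gs_poly S_form n"
  define p where "p = gs_poly L2_form"
  have leg: "legendre P i = pol (p i)" for i by (simp add: legendre_pol p_def)
  have sob: "sobolev m chi P n = pol s" by (simp add: sobolev_pol s_def)
  have xi: "xi_inv_sq m chi P n = S_form s s"
    by (simp add: xi_inv_sq_def sob sobolev_inner_pol)
  have coef: "xi_inv_sq m chi P n * coeff_a m chi P (int n + int m - int l - 1) (2 * int m - int l - 1)
      = S_form ((green_poly ^^ m) (p (n + m - l))) s" if l: "l \<in> {1..2*m}" for l
  proof -
    \<comment> \<open>With N = n + m - l - 1 and second index 2m - l - 1, the Sobolev polynomial in
      \<open>coeff_a\<close> has index N + m - (2m - l - 1) = n for every \<open>l\<close>, and the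
      Green image is that of the Legendre polynomial of index N + 1 = n + m - l. The bounds on
      \<open>l\<close> and \<open>n\<close> keep truncation to \<open>nat\<close> harmless.\<close>
    have N: "nat (int n + int m - int l - 1 + int m - (2 * int m - int l - 1)) = n"
      "nat (int n + int m - int l - 1 + int m + 1) - m = n + m - l"
      using l assms(6) by auto
    have "sobolev_inner m chi (green_legendre m P (nat (int n + int m - int l - 1 + int m + 1))) (pol s)
        = S_form ((green_poly ^^ m) (p (n + m - l))) s"
      unfolding green_legendre_def N leg by (rule sobolev_inner_pol) (simp_all add: green_pow_pol)
    then show ?thesis
      \<comment> \<open>The squared norm of \<open>s\<close> is the denominator of
        \<open>coeff_a\<close>; it is positive and cancels.\<close>
      unfolding coeff_a_def Let_def N xi sob
      using S.gs_pos[of n] by (simp add: s_def[symmetric] sobolev_inner_pol)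
  qed
  have "sobolev m chi P n x + (\<Sum>l=1..m. chi l * (laplacian ^^ (2 * l)) (sobolev m chi P n) x)
      = (\<Sum>l\<le>m. chi l * pol (poly_shift (2 * l) s) x)"
  proof -
    have "{..m} = insert 0 {1..m}" by auto
    then show ?thesis using x assms(3) by (simp add: sob laplacian_pow_pol)
  qed
  also have "\<dots> = pol (poly_shift m (repr s)) x"
    by (simp add: poly_shift_repr pol_sum pol_smult)
  also have "\<dots> = (laplacian ^^ m) (pol (repr s)) x"
    using laplacian_pow_pol[OF x] by simp
  also have "\<dots> = pol (poly_shift m (p (n + m))) x +
      (\<Sum>l=1..2*m. S_form ((green_poly ^^ m) (p (n + m - l))) s / L2_form (p (n + m - l)) (p (n + m - l))
        * pol (poly_shift m (p (n + m - l))) x)"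
  proof -
    have add: "poly_shift m (c + d) = poly_shift m c + poly_shift m d"
      and smult: "poly_shift m (smult a c) = smult a (poly_shift m c)" for c d :: "real poly" and a
      by (rule poly_eqI; simp add: coeff_poly_shift)+
    have sum: "poly_shift m (\<Sum>i\<in>A. c i) = (\<Sum>i\<in>A. poly_shift m (c i))" for A :: "nat set" and c :: "nat \<Rightarrow> real poly"
      by (rule poly_eqI) (simp add: coeff_poly_shift coeff_sum)
    show ?thesis
      using repr_expansion[OF assms(6)] laplacian_pow_pol[OF x, of m "repr s"]
      by (simp add: s_def p_def add smult sum pol_add pol_sum pol_smult)
  qed
  also have "\<dots> = (laplacian ^^ m) (legendre P (n + m)) x
      + (\<Sum>l=1..2*m. d_sq P (n + m - l) * xi_inv_sq m chi P n
           * coeff_a m chi P (int n + int m - int l - 1) (2 * int m - int l - 1)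
           * (laplacian ^^ m) (legendre P (n + m - l)) x)"
    unfolding leg laplacian_pow_pol[OF x]
  proof (intro arg_cong2[where f = "(+)"] refl sum.cong)
    fix l assume l: "l \<in> {1..2*m}"
    have "d_sq P (n + m - l) = inverse (L2_form (p (n + m - l)) (p (n + m - l)))"
      by (simp add: d_sq_def leg L2_form_def)
    then show "S_form ((green_poly ^^ m) (p (n + m - l))) s / L2_form (p (n + m - l)) (p (n + m - l))
          * pol (poly_shift m (p (n + m - l))) x
        = d_sq P (n + m - l) * xi_inv_sq m chi P n
           * coeff_a m chi P (int n + int m - int l - 1) (2 * int m - int l - 1)
           * pol (poly_shift m (p (n + m - l))) x"
      unfolding mult.assoc[of "d_sq _ _"] coef[OF l] by (simp add: divide_inverse)
  qed
  finally show "sobolev m chi P n x + (\<Sum>l=1..m. chi l * (laplacian ^^ (2 * l)) (sobolev m chi P n) x)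
    = (laplacian ^^ m) (legendre P (n + m)) x
      + (\<Sum>l=1..2*m. d_sq P (n + m - l) * xi_inv_sq m chi P n
           * coeff_a m chi P (int n + int m - int l - 1) (2 * int m - int l - 1)
           * (laplacian ^^ m) (legendre P (n + m - l)) x)" .
qed

end
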